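(* Let $r\ge1$ and $d\ge1$. The number of $r$-tuples $(g_1,\dots,g_r)$ of permutations in the symmetric group $S_d$, counted up to simultaneous conjugation by $S_d$, that generate a transitive subgroup of $S_d$ equals $$\frac1d\sum_{m\mid d}m\,\mu(d/m)\sum_{\substack{n_1,\dots,n_m\ge0\\ \sum_kkn_k=m}}(-1)^{\ell-1}\frac{(\ell-1)!}{n_1!\cdots n_m!}\prod_{k=1}^m\Big(\sum_{\kappa\vdash k}z_\kappa^{\,r-1}\Big)^{n_k},\qquad\ell=\textstyle\sum_kn_k,$$ where for a partition $\kappa=(1^{m_1}2^{m_2}\cdots k^{m_k})$ of $k$, $z_\kappa=\prod_{j}j^{m_j}m_j!$.
   Context: $\mu$ is the classical Möbius function; $\kappa\vdash k$ means $\kappa$ ranges over partitions of $k$; $z_\kappa$ is the order of the centralizer in $S_k$ of a permutation of cycle type $\kappa$. *)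

theory Defs
  imports Complex_Main "HOL-Algebra.Sym_Groups" "HOL-Computational_Algebra.Squarefree"
begin

definition moebius_mu :: "nat \<Rightarrow> int" where
  "moebius_mu n = (if n = 0 then 0 else if squarefree n then (-1) ^ card (prime_factors n) else 0)"

definition perm_tuples :: "nat \<Rightarrow> nat \<Rightarrow> (nat \<Rightarrow> nat) list set" where
  "perm_tuples r d = {gs. length gs = r \<and> set gs \<subseteq> carrier (sym_group d)}"

definition transitive_tuple :: "nat \<Rightarrow> (nat \<Rightarrow> nat) list \<Rightarrow> bool" where
  "transitive_tuple d gs \<longleftrightarrow>
     (\<forall>i\<in>{1..d}. \<forall>j\<in>{1..d}. \<exists>h\<in>generate (sym_group d) (set gs). h i = j)"

definition sim_conj :: "nat \<Rightarrow> ((nat \<Rightarrow> nat) list \<times> (nat \<Rightarrow> nat) list) set" where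
  "sim_conj d = {(gs, hs). \<exists>\<sigma>\<in>carrier (sym_group d).
      hs = map (\<lambda>g. \<sigma> \<otimes>\<^bsub>sym_group d\<^esub> g \<otimes>\<^bsub>sym_group d\<^esub> inv\<^bsub>sym_group d\<^esub> \<sigma>) gs}"

definition num_transitive_classes :: "nat \<Rightarrow> nat \<Rightarrow> nat" where
  "num_transitive_classes r d =
     card ({gs \<in> perm_tuples r d. transitive_tuple d gs} // sim_conj d)"

(* multiplicity vectors n with support in {1..m} and sum_k k * n_k = m;
   for m = k these are exactly the partitions (1^{m_1} 2^{m_2} ... k^{m_k}) of k *)
definition mult_vectors :: "nat \<Rightarrow> (nat \<Rightarrow> nat) set" where
  "mult_vectors m = {n. (\<forall>k. n k \<noteq> 0 \<longrightarrow> k \<in> {1..m}) \<and> (\<Sum>k=1..m. k * n k) = m}"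

definition z_part :: "nat \<Rightarrow> (nat \<Rightarrow> nat) \<Rightarrow> nat" where
  "z_part k mm = (\<Prod>j=1..k. j ^ mm j * fact (mm j))"

definition theorem8_formula :: "nat \<Rightarrow> nat \<Rightarrow> real" where
  "theorem8_formula r d =
    (1 / real d) * (\<Sum>m | m dvd d.
       real m * real_of_int (moebius_mu (d div m)) *
       (\<Sum>n\<in>mult_vectors m.
          (let l = (\<Sum>k=1..m. n k) in
            (-1) ^ (l - 1) * fact (l - 1) / (\<Prod>k=1..m. fact (n k)) *
            (\<Prod>k=1..m. (\<Sum>\<kappa>\<in>mult_vectors k. real (z_part k \<kappa>) ^ (r - 1)) ^ n k))))"

end

theory Submission
  imports Defs "HOL-Computational_Algebra.Formal_Power_Series"
begin

text \<open>An \<open>r\<close>-tuple of permutations of a finite set is an action of the free group of rank \<open>r\<close>,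
  and simultaneous conjugacy is isomorphism of actions. Decomposing into orbits, the isomorphism
  classes of actions on \<open>m\<close> points correspond to multisets of isomorphism classes of transitive
  actions of total size \<open>m\<close>. Hence, if \<open>a\<^sub>m\<close> counts all classes and \<open>t\<^sub>e\<close> the transitive ones,
  \<open>m a\<^sub>m = \<Sum>\<^sub>j c\<^sub>j a\<^bsub>m-j\<^esub>\<close> with \<open>c\<^sub>j = \<Sum>\<^bsub>e dvd j\<^esub> e t\<^sub>e\<close>. On generating functions this says
  \<open>C = X (log A)'\<close>; expanding the logarithm gives \<open>c\<^sub>m\<close> as the inner sum of the formula
  (times \<open>m\<close>), and Moebius inversion gives \<open>d t\<^sub>d\<close>.

  By Burnside's lemma \<open>k! a\<^sub>k\<close> is the sum over \<open>\<sigma>\<close> in \<open>S\<^sub>k\<close> of the \<open>r\<close>-th powers of the centralizer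
  orders. The case \<open>r = 1\<close> of the theory of actions shows that \<open>z\<^sub>\<kappa>\<close> is the order of the
  centralizer and that \<open>k! / z\<^sub>\<kappa>\<close> permutations have cycle type \<open>\<kappa>\<close>, so
  \<open>a\<^sub>k = \<Sum>\<^sub>\<kappa> z\<^sub>\<kappa>\<^bsup>r-1\<^esup>\<close>.\<close>

section \<open>Finite actions and their orbits\<close>

text \<open>No group acts explicitly: an action is a family of \<open>r\<close> bijections of a
  finite carrier, a tuple \<open>gs\<close> enters as the family \<open>nth gs\<close>, and orbits
  are classes of reachability by forward steps. The carrier type stays free because disjoint unions
  are formed on pairs before they are carried back to an interval. Everything about isomorphism
  rests on one count, \<open>card_isos_split_orb\<close>: an isomorphism chooses the image of a
  fixed orbit and then splits into two independent isomorphisms. Read as a statement about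
  nonemptiness, for any \<open>r\<close>, it gives cancellation, so that the types of the orbits
  determine an action; read as an exact number, for \<open>r = 1\<close>, it is the recursion of
  \<open>z_part\<close>. For this reason isomorphisms between different actions are counted, not
  only automorphisms. The same choice reduces both Burnside's lemma and the size of a conjugacy
  class to \<open>sum_card_isos_perm_tuple\<close>.\<close>

definition fin_action :: "nat \<Rightarrow> 'a set \<Rightarrow> (nat \<Rightarrow> 'a \<Rightarrow> 'a) \<Rightarrow> bool" where
  "fin_action r A s \<longleftrightarrow> finite A \<and> (\<forall>i<r. bij_betw (s i) A A)"

text \<open>Extensionality makes isomorphisms that agree on \<open>A\<close> equal, so that they can be counted.\<close>
definition isos :: "nat \<Rightarrow> 'a set \<Rightarrow> (nat \<Rightarrow> 'a \<Rightarrow> 'a) \<Rightarrow> 'b set \<Rightarrow> (nat \<Rightarrow> 'b \<Rightarrow> 'b) \<Rightarrow> ('a \<Rightarrow> 'b) set" where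
  "isos r A s B t = {f \<in> extensional A. bij_betw f A B \<and> (\<forall>i<r. \<forall>x\<in>A. f (s i x) = t i (f x))}"

text \<open>The reflexive closure ranges over the whole type; \<open>Restr\<close> removes the
  diagonal outside \<open>A\<close>. No backward steps are put in: symmetry will follow from
  finiteness.\<close>

definition reach :: "nat \<Rightarrow> 'a set \<Rightarrow> (nat \<Rightarrow> 'a \<Rightarrow> 'a) \<Rightarrow> ('a \<times> 'a) set" where
  "reach r A s = Restr ({(x, s i x) | i x. i < r \<and> x \<in> A}\<^sup>*) A"

definition orbs :: "nat \<Rightarrow> 'a set \<Rightarrow> (nat \<Rightarrow> 'a \<Rightarrow> 'a) \<Rightarrow> 'a set set" where
  "orbs r A s = A // reach r A s"

text \<open>Excluding the empty action gives every transitive type a positive size, without which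
  there would be infinitely many multisets of types of a given total size.\<close>

definition trans_action :: "nat \<Rightarrow> 'a set \<Rightarrow> (nat \<Rightarrow> 'a \<Rightarrow> 'a) \<Rightarrow> bool" where
  "trans_action r A s \<longleftrightarrow> A \<noteq> {} \<and> (\<forall>x\<in>A. \<forall>y\<in>A. (x, y) \<in> reach r A s)"

lemma fin_actionD:
  assumes "fin_action r A s"
  shows "finite A" "i < r \<Longrightarrow> bij_betw (s i) A A" "i < r \<Longrightarrow> x \<in> A \<Longrightarrow> s i x \<in> A"
  using assms bij_betwE unfolding fin_action_def by blast+

lemma reach_refl: "x \<in> A \<Longrightarrow> (x, x) \<in> reach r A s"
  by (simp add: reach_def)

lemma reach_trans: "(x, y) \<in> reach r A s \<Longrightarrow> (y, z) \<in> reach r A s \<Longrightarrow> (x, z) \<in> reach r A s"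
  by (auto simp: reach_def)

lemma reach_in: "(x, y) \<in> reach r A s \<Longrightarrow> x \<in> A \<and> y \<in> A"
  by (auto simp: reach_def)

lemma reach_step:
  assumes "fin_action r A s" "i < r" "x \<in> A"
  shows "(x, s i x) \<in> reach r A s"
  using fin_actionD(3)[OF assms] assms unfolding reach_def by blast

lemma reach_induct [consumes 2, case_names refl step]:
  assumes "(x, y) \<in> reach r A s" "fin_action r A s"
    and "P x" and "\<And>y i. (x, y) \<in> reach r A s \<Longrightarrow> y \<in> A \<Longrightarrow> P y \<Longrightarrow> i < r \<Longrightarrow> P (s i y)"
  shows "P y"
proof -
  have x: "x \<in> A" using assms(1) by (auto simp: reach_def)
  have "(x, y) \<in> {(x, s i x) | i x. i < r \<and> x \<in> A}\<^sup>*" using assms(1) by (auto simp: reach_def)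
  then have "P y \<and> (x, y) \<in> reach r A s"
  proof (induction rule: rtrancl_induct)
    case base then show ?case using assms(3) x by (simp add: reach_refl)
  next
    case (step y z)
    from step(2) obtain i where i: "i < r" "y \<in> A" "z = s i y" by auto
    show ?case
      using assms(4)[of y i] step(3) i reach_trans[OF _ reach_step[OF assms(2) i(1,2)], of x] by simp
  qed
  then show ?thesis by simp
qed

text \<open>Finiteness makes a forward invariant set invariant under the inverses as well.\<close>
lemma reach_back:
  assumes a: "fin_action r A s" and "i < r" "x \<in> A"
  shows "(s i x, x) \<in> reach r A s"
proof -
  define S where "S = {y. (s i x, y) \<in> reach r A s}"
  have S: "y \<in> S \<longleftrightarrow> (s i x, y) \<in> reach r A s" for y by (simp add: S_def)
  have sub: "S \<subseteq> A" using reach_in by (fastforce simp: S)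
  have fin: "finite S" by (rule finite_subset[OF sub fin_actionD(1)[OF a]])
  have inv: "s i ` S \<subseteq> S"
  proof
    fix z assume "z \<in> s i ` S"
    then obtain y where y: "y \<in> S" "z = s i y" by (rule imageE)
    then have "(y, z) \<in> reach r A s" using reach_step[OF a \<open>i < r\<close>] sub by auto
    then show "z \<in> S" using y(1) unfolding S by (rule reach_trans[rotated])
  qed
  have inj: "inj_on (s i) A" using bij_betw_imp_inj_on[OF fin_actionD(2)[OF a \<open>i < r\<close>]] .
  have eq: "s i ` S = S" by (rule endo_inj_surj[OF fin inv inj_on_subset[OF inj sub]])
  have "s i x \<in> S" unfolding S by (rule reach_refl[OF fin_actionD(3)[OF assms]])
  then obtain y where y: "y \<in> S" "s i y = s i x" by (metis eq imageE)
  then have "y = x" using inj_onD[OF inj y(2)] sub \<open>x \<in> A\<close> by auto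
  then show ?thesis using y(1) by (simp add: S)
qed

lemma reach_sym:
  assumes "fin_action r A s" "(x, y) \<in> reach r A s"
  shows "(y, x) \<in> reach r A s"
  using assms(2,1)
proof (induction rule: reach_induct)
  case refl show ?case using reach_in[OF assms(2)] by (simp add: reach_refl)
next
  case (step y i) show ?case by (rule reach_trans[OF reach_back[OF assms(1) step.hyps(3,2)] step.IH])
qed

lemma equiv_reach:
  assumes "fin_action r A s"
  shows "equiv A (reach r A s)"
proof (rule equivI)
  show "reach r A s \<subseteq> A \<times> A" by (auto simp: reach_def)
  show "refl_on A (reach r A s)" by (rule refl_onI) (auto simp: reach_def)
  show "sym (reach r A s)" by (rule symI) (rule reach_sym[OF assms])
  show "trans (reach r A s)" by (rule transI) (rule reach_trans)
qed

section \<open>Invariant subsets, single orbits and their complements\<close>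

definition invariant :: "nat \<Rightarrow> 'a set \<Rightarrow> (nat \<Rightarrow> 'a \<Rightarrow> 'a) \<Rightarrow> 'a set \<Rightarrow> bool" where
  "invariant r A s C \<longleftrightarrow> C \<subseteq> A \<and> (\<forall>i<r. \<forall>x\<in>C. s i x \<in> C)"

lemma fin_action_invariant:
  assumes a: "fin_action r A s" and C: "invariant r A s C"
  shows "fin_action r C s"
  unfolding fin_action_def
proof (intro conjI allI impI)
  have sub: "C \<subseteq> A" using C by (simp add: invariant_def)
  show fin: "finite C" by (rule finite_subset[OF sub fin_actionD(1)[OF a]])
  fix i assume i: "i < r"
  have "inj_on (s i) C" by (rule inj_on_subset[OF bij_betw_imp_inj_on[OF fin_actionD(2)[OF a i]] sub])
  moreover have "s i ` C \<subseteq> C" using C i by (auto simp: invariant_def)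
  ultimately show "bij_betw (s i) C C" using endo_inj_surj[OF fin] by (simp add: bij_betw_def)
qed

text \<open>A path that starts in an invariant set never leaves it, so passing to \<open>C\<close>
  loses no paths between points of \<open>C\<close>.\<close>

lemma reach_invariant:
  assumes a: "fin_action r A s" and C: "invariant r A s C"
  shows "reach r C s = Restr (reach r A s) C"
proof -
  have aC: "fin_action r C s" by (rule fin_action_invariant[OF assms])
  have sub: "C \<subseteq> A" using C by (simp add: invariant_def)
  have 1: "(x, y) \<in> reach r A s" if "(x, y) \<in> reach r C s" for x y
    using that aC
  proof (induction rule: reach_induct)
    case refl show ?case using reach_in[OF that] sub by (auto intro: reach_refl)
  next
    case (step y i)
    have "y \<in> A" using step.hyps(2) sub by auto
    then show ?case by (rule reach_trans[OF step.IH reach_step[OF a step.hyps(3)]])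
  qed
  have 2: "x \<in> C \<Longrightarrow> (x, y) \<in> reach r C s" if "(x, y) \<in> reach r A s" for x y
    using that a
  proof (induction rule: reach_induct)
    case refl show ?case using refl.prems by (rule reach_refl)
  next
    case (step y i)
    have xy: "(x, y) \<in> reach r C s" using step by simp
    then have "y \<in> C" by (auto dest: reach_in)
    then show ?case by (rule reach_trans[OF xy reach_step[OF aC step.hyps(3)]])
  qed
  show ?thesis using 1 2 by (auto dest: reach_in)
qed

lemma orbs_eqD: "O' \<in> orbs r A s \<Longrightarrow> x \<in> O' \<Longrightarrow> fin_action r A s \<Longrightarrow> O' = reach r A s `` {x}"
  unfolding orbs_def by (metis equiv_class_eq equiv_reach Image_singleton_iff quotientE)

lemma orbs_subset: "fin_action r A s \<Longrightarrow> O' \<in> orbs r A s \<Longrightarrow> O' \<subseteq> A"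
  unfolding orbs_def using equiv_reach in_quotient_imp_subset by blast

lemma orbs_nonempty: "fin_action r A s \<Longrightarrow> O' \<in> orbs r A s \<Longrightarrow> O' \<noteq> {}"
  unfolding orbs_def using equiv_reach in_quotient_imp_non_empty by blast

lemma Union_orbs: "fin_action r A s \<Longrightarrow> \<Union> (orbs r A s) = A"
  unfolding orbs_def using equiv_reach Union_quotient by blast

lemma orbs_disjoint: "fin_action r A s \<Longrightarrow> O1 \<in> orbs r A s \<Longrightarrow> O2 \<in> orbs r A s \<Longrightarrow> O1 \<noteq> O2 \<Longrightarrow> O1 \<inter> O2 = {}"
  unfolding orbs_def using equiv_reach quotient_disj by blast

lemma finite_orbs: "fin_action r A s \<Longrightarrow> finite (orbs r A s)"
  using Union_orbs fin_actionD(1) finite_UnionD by metis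

lemma finite_orb: "fin_action r A s \<Longrightarrow> O' \<in> orbs r A s \<Longrightarrow> finite O'"
  using orbs_subset fin_actionD(1) finite_subset by metis

lemma invariant_orb:
  assumes a: "fin_action r A s" and O': "O' \<in> orbs r A s"
  shows "invariant r A s O'"
proof -
  have "s i x \<in> O'" if "i < r" "x \<in> O'" for i x
    using orbs_eqD[OF O' that(2) a] reach_step[OF a that(1)] that(2) orbs_subset[OF a O'] by blast
  then show ?thesis using orbs_subset[OF a O'] by (auto simp: invariant_def)
qed

text \<open>A step from outside into \<open>O'\<close> could be undone by \<open>reach_back\<close>,
  which would put its source into \<open>O'\<close> too.\<close>

lemma invariant_Diff_orb:
  assumes a: "fin_action r A s" and O': "O' \<in> orbs r A s"
  shows "invariant r A s (A - O')"
proof -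
  have "s i x \<notin> O'" if i: "i < r" and x: "x \<in> A" "x \<notin> O'" for i x
  proof
    assume m: "s i x \<in> O'"
    have "x \<in> O'" using reach_back[OF a i x(1)] orbs_eqD[OF O' m a] by blast
    then show False using x(2) by blast
  qed
  then show ?thesis using fin_actionD(3)[OF a] by (auto simp: invariant_def)
qed

lemma trans_action_orb:
  assumes a: "fin_action r A s" and O': "O' \<in> orbs r A s"
  shows "trans_action r O' s"
proof -
  have "(x, y) \<in> reach r A s" if "x \<in> O'" "y \<in> O'" for x y
    using orbs_eqD[OF O' that(1) a] that by blast
  then show ?thesis
    using orbs_nonempty[OF a O'] reach_invariant[OF a invariant_orb[OF a O']]
    unfolding trans_action_def by blast
qed

lemma fin_action_orb:
  assumes "fin_action r A s" "O' \<in> orbs r A s"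
  shows "fin_action r O' s" "fin_action r (A - O') s"
  using assms fin_action_invariant invariant_orb invariant_Diff_orb by blast+

lemma orbs_memI: "fin_action r A s \<Longrightarrow> x \<in> A \<Longrightarrow> reach r A s `` {x} \<in> orbs r A s"
  unfolding orbs_def by (rule quotientI)

text \<open>By symmetry no point outside \<open>O'\<close> reaches \<open>O'\<close>, so the other
  classes stay as they are. This supports the inductions that strip off one orbit at a time.\<close>

lemma orbs_Diff_orb:
  assumes a: "fin_action r A s" and O': "O' \<in> orbs r A s"
  shows "orbs r (A - O') s = orbs r A s - {O'}"
proof -
  have a': "fin_action r (A - O') s" using fin_action_orb(2)[OF assms] .
  have cls: "reach r (A - O') s `` {x} = reach r A s `` {x}" if x: "x \<in> A - O'" for x
  proof -
    have "y \<notin> O'" if "(x, y) \<in> reach r A s" for y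
      using orbs_eqD[OF O' _ a, of y] reach_sym[OF a that] x by blast
    then show ?thesis
      using x by (auto simp: reach_invariant[OF a invariant_Diff_orb[OF assms]] dest: reach_in)
  qed
  show ?thesis
  proof (intro Set.set_eqI iffI)
    fix P assume "P \<in> orbs r (A - O') s"
    then obtain x where x: "x \<in> A - O'" "P = reach r (A - O') s `` {x}" unfolding orbs_def by (rule quotientE)
    then show "P \<in> orbs r A s - {O'}"
      using cls[OF x(1)] orbs_memI[OF a, of x] reach_refl[of x A r s] by auto
  next
    fix P assume P: "P \<in> orbs r A s - {O'}"
    then obtain x where x: "x \<in> P" using orbs_nonempty[OF a] by blast
    have xA: "x \<in> A - O'" using P x orbs_disjoint[OF a, of P O'] O' orbs_subset[OF a, of P] by blast
    then show "P \<in> orbs r (A - O') s"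
      using cls[OF xA] orbs_eqD[OF _ x a] P orbs_memI[OF a' xA] by auto
  qed
qed

section \<open>The groupoid of isomorphisms and its effect on orbits\<close>

lemma isosD:
  assumes "f \<in> isos r A s B t"
  shows "f \<in> extensional A" "bij_betw f A B" "inj_on f A" "f ` A = B"
    "i < r \<Longrightarrow> x \<in> A \<Longrightarrow> f (s i x) = t i (f x)" "x \<in> A \<Longrightarrow> f x \<in> B"
  using assms unfolding isos_def bij_betw_def by auto

lemma isos_restrict:
  assumes "fin_action r A s" "bij_betw f A B" "\<And>i x. i < r \<Longrightarrow> x \<in> A \<Longrightarrow> f (s i x) = t i (f x)"
  shows "restrict f A \<in> isos r A s B t"
  using assms fin_actionD(3)[OF assms(1)] unfolding isos_def by (auto cong: bij_betw_cong)

lemma isos_compose: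
  assumes a: "fin_action r A s" and f: "f \<in> isos r A s B t" and g: "g \<in> isos r B t C u"
  shows "restrict (g \<circ> f) A \<in> isos r A s C u"
  using isosD[OF f] isosD[OF g] by (intro isos_restrict[OF a] bij_betw_trans[of f A B]) auto

lemma isos_inverse:
  assumes a: "fin_action r A s" and b: "fin_action r B t" and f: "f \<in> isos r A s B t"
  shows "restrict (inv_into A f) B \<in> isos r B t A s"
proof (intro isos_restrict[OF b] bij_betw_inv_into isosD(2)[OF f])
  fix i x assume i: "i < r" and x: "x \<in> B"
  then obtain y where y: "y \<in> A" "x = f y" using isosD(4)[OF f] by blast
  then show "inv_into A f (t i x) = s i (inv_into A f x)"
    using isosD(5)[OF f i y(1)] inv_into_f_f[OF isosD(3)[OF f]] fin_actionD(3)[OF a i y(1)] by metis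
qed

lemma fin_action_iso:
  assumes a: "fin_action r A s" and f: "f \<in> isos r A s B t"
  shows "fin_action r B t"
  unfolding fin_action_def
proof (intro conjI allI impI)
  show "finite B" using fin_actionD(1)[OF a] isosD(4)[OF f] by blast
  fix i assume i: "i < r"
  have "bij_betw (f \<circ> s i \<circ> inv_into A f) B B"
    using bij_betw_trans[OF bij_betw_inv_into[OF isosD(2)[OF f]] bij_betw_trans[OF fin_actionD(2)[OF a i] isosD(2)[OF f]]]
    by (simp add: comp_assoc)
  moreover have "(f \<circ> s i \<circ> inv_into A f) x = t i x" if "x \<in> B" for x
    using that isosD(4,5)[OF f] i by (metis comp_apply f_inv_into_f inv_into_into)
  ultimately show "bij_betw (t i) B B" using bij_betw_cong by blast
qed

lemma finite_isos:
  assumes "fin_action r A s" "finite B"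
  shows "finite (isos r A s B t)"
proof (rule finite_subset[of _ "A \<rightarrow>\<^sub>E B"])
  show "isos r A s B t \<subseteq> A \<rightarrow>\<^sub>E B" 
  proof
    fix f assume "f \<in> isos r A s B t"
    from isosD(1)[OF this] isosD(6)[OF this] show "f \<in> A \<rightarrow>\<^sub>E B" by (simp add: PiE_iff)
  qed
  show "finite (A \<rightarrow>\<^sub>E B)" using assms by (simp add: finite_PiE fin_action_def)
qed

lemma card_isos_eq:
  assumes "isos r A s B t \<noteq> {}"
  shows "card A = card B"
  using assms bij_betw_same_card[OF isosD(2)] by blast

text \<open>All isomorphism sets between isomorphic actions are torsors over the same group.\<close>
lemma card_isos_transport:
  assumes a: "fin_action r A s" and b: "fin_action r B t" and f: "f \<in> isos r A s B t"
  shows "card (isos r A s C u) = card (isos r B t C u)"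
proof -
  define f' where "f' = restrict (inv_into A f) B"
  have f': "f' \<in> isos r B t A s" unfolding f'_def by (rule isos_inverse[OF a b f])
  have ff: "f' (f x) = x" if "x \<in> A" for x
    using that isosD(3,6)[OF f] by (simp add: f'_def)
  have ff': "f (f' y) = y" if "y \<in> B" for y
    using that isosD(4)[OF f] by (simp add: f'_def f_inv_into_f)
  show ?thesis
  proof (rule bij_betw_same_card[of "\<lambda>g. restrict (g \<circ> f') B"], rule bij_betw_byWitness[where f' = "\<lambda>g. restrict (g \<circ> f) A"])
    show "\<forall>g\<in>isos r A s C u. restrict (restrict (g \<circ> f') B \<circ> f) A = g"
    proof
      fix g assume "g \<in> isos r A s C u"
      from isosD(1)[OF this] show "restrict (restrict (g \<circ> f') B \<circ> f) A = g"
        using ff isosD(6)[OF f] by (auto intro!: ext simp: restrict_def extensional_def)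
    qed
    show "\<forall>g\<in>isos r B t C u. restrict (restrict (g \<circ> f) A \<circ> f') B = g"
    proof
      fix g assume "g \<in> isos r B t C u"
      from isosD(1)[OF this] show "restrict (restrict (g \<circ> f) A \<circ> f') B = g"
        using ff' isosD(6)[OF f'] by (auto intro!: ext simp: restrict_def extensional_def)
    qed
  qed (use isos_compose[OF a f] isos_compose[OF b f'] in auto)
qed

lemma reach_iso:
  assumes a: "fin_action r A s" and f: "f \<in> isos r A s B t" and xy: "(x, y) \<in> reach r A s"
  shows "(f x, f y) \<in> reach r B t"
  using xy a
proof (induction rule: reach_induct)
  case refl show ?case using reach_in[OF xy] isosD(6)[OF f] by (simp add: reach_refl)
next
  case (step y i)
  then show ?case
    using reach_trans[OF step.IH reach_step[OF fin_action_iso[OF a f] step.hyps(3)]]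
      isosD(5)[OF f step.hyps(3,2)] isosD(6)[OF f step.hyps(2)] by simp
qed

lemma reach_iso_iff:
  assumes a: "fin_action r A s" and f: "f \<in> isos r A s B t" and xy: "x \<in> A" "y \<in> A"
  shows "(f x, f y) \<in> reach r B t \<longleftrightarrow> (x, y) \<in> reach r A s"
proof
  have b: "fin_action r B t" by (rule fin_action_iso[OF a f])
  assume "(f x, f y) \<in> reach r B t"
  then have "(restrict (inv_into A f) B (f x), restrict (inv_into A f) B (f y)) \<in> reach r A s"
    by (rule reach_iso[OF b isos_inverse[OF a b f]])
  then show "(x, y) \<in> reach r A s" using xy isosD(3,6)[OF f] by simp
qed (rule reach_iso[OF a f])

lemma trans_action_iso:
  assumes a: "fin_action r A s" and f: "f \<in> isos r A s B t" and "trans_action r A s"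
  shows "trans_action r B t"
  using assms(3) reach_iso[OF a f] isosD(4)[OF f] unfolding trans_action_def by blast

lemma orbs_iso:
  assumes a: "fin_action r A s" and f: "f \<in> isos r A s B t"
  shows "orbs r B t = (`) f ` orbs r A s"
proof -
  have cls: "reach r B t `` {f x} = f ` (reach r A s `` {x})" if "x \<in> A" for x

  proof (intro Set.set_eqI iffI)
    fix z assume "z \<in> reach r B t `` {f x}"
    then have z: "(f x, z) \<in> reach r B t" by simp
    have "z \<in> f ` A" using reach_in[OF z] isosD(4)[OF f] by simp
    then obtain y where "y \<in> A" "z = f y" by (rule imageE)
    then show "z \<in> f ` (reach r A s `` {x})" using z reach_iso_iff[OF a f that] by auto
  qed (use reach_iso[OF a f] in auto)
  have "orbs r B t = (\<lambda>x. reach r B t `` {x}) ` B" by (auto simp: orbs_def quotient_def)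
  also have "\<dots> = (\<lambda>x. reach r B t `` {f x}) ` A" using isosD(4)[OF f] by blast
  also have "\<dots> = (\<lambda>x. f ` (reach r A s `` {x})) ` A" using cls by (rule image_cong[OF refl])
  also have "\<dots> = (`) f ` orbs r A s" by (auto simp: orbs_def quotient_def)
  finally show ?thesis .
qed

lemma iso_restrict_invariant:
  assumes a: "fin_action r A s" and f: "f \<in> isos r A s B t" and C: "invariant r A s C"
  shows "restrict f C \<in> isos r C s (f ` C) t"
proof (rule isos_restrict[OF fin_action_invariant[OF a C]])
  have "C \<subseteq> A" using C by (simp add: invariant_def)
  then show "bij_betw f C (f ` C)" using isosD(2)[OF f] bij_betw_subset by blast
  show "f (s i x) = t i (f x)" if "i < r" "x \<in> C" for i x
    using that isosD(5)[OF f] \<open>C \<subseteq> A\<close> by blast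
qed

text \<open>An isomorphism maps \<open>O'\<close> onto some orbit \<open>P\<close>, hence the
  complement of \<open>O'\<close> onto that of \<open>P\<close>, and it is the gluing of the two
  restrictions. Conversely any two such pieces glue, since both domains are invariant.\<close>

lemma card_isos_split_orb:
  assumes a: "fin_action r A s" and b: "fin_action r B t" and O': "O' \<in> orbs r A s"
  shows "card (isos r A s B t) =
    (\<Sum>P\<in>orbs r B t. card (isos r O' s P t) * card (isos r (A - O') s (B - P) t))"
proof -
  let ?F = "\<lambda>P. {f \<in> isos r A s B t. f ` O' = P}"
  have sub: "O' \<subseteq> A" by (rule orbs_subset[OF a O'])
  have un: "isos r A s B t = (\<Union>P\<in>orbs r B t. ?F P)"

  proof (intro equalityI subsetI)
    fix f assume f: "f \<in> isos r A s B t"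
    have "f ` O' \<in> orbs r B t" using O' by (simp add: orbs_iso[OF a f])
    then show "f \<in> (\<Union>P\<in>orbs r B t. ?F P)" using f by simp
  qed simp
  have fin: "finite (isos r A s B t)" using finite_isos[OF a fin_actionD(1)[OF b]] .
  have "card (isos r A s B t) = (\<Sum>P\<in>orbs r B t. card (?F P))"
    by (subst un, rule card_UN_disjoint) (use finite_orbs[OF b] fin in auto)
  also have "\<dots> = (\<Sum>P\<in>orbs r B t. card (isos r O' s P t \<times> isos r (A - O') s (B - P) t))"
  proof (intro sum.cong refl bij_betw_same_card)
    fix P assume P: "P \<in> orbs r B t"
    have PB: "P \<subseteq> B" by (rule orbs_subset[OF b P])
    show "bij_betw (\<lambda>f. (restrict f O', restrict f (A - O'))) (?F P)
      (isos r O' s P t \<times> isos r (A - O') s (B - P) t)"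
    proof (rule bij_betw_byWitness[where f' = "\<lambda>(g, h) x. if x \<in> O' then g x else h x"])
      show "\<forall>f\<in>?F P. (case (restrict f O', restrict f (A - O')) of (g, h) \<Rightarrow> \<lambda>x. if x \<in> O' then g x else h x) = f"
      proof
        fix f assume "f \<in> ?F P"
        then have "f \<in> extensional A" by (simp add: isos_def)
        then show "(case (restrict f O', restrict f (A - O')) of (g, h) \<Rightarrow> \<lambda>x. if x \<in> O' then g x else h x) = f"
          using sub by (auto intro!: ext simp: restrict_def extensional_def)
      qed
      show "\<forall>gh\<in>isos r O' s P t \<times> isos r (A - O') s (B - P) t.
        (\<lambda>f. (restrict f O', restrict f (A - O'))) (case gh of (g, h) \<Rightarrow> \<lambda>x. if x \<in> O' then g x else h x) = gh"
      proof
        fix gh assume "gh \<in> isos r O' s P t \<times> isos r (A - O') s (B - P) t"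
        then obtain g h where "gh = (g, h)" "g \<in> extensional O'" "h \<in> extensional (A - O')"
          by (auto simp: isos_def)
        then show "(\<lambda>f. (restrict f O', restrict f (A - O'))) (case gh of (g, h) \<Rightarrow> \<lambda>x. if x \<in> O' then g x else h x) = gh"
          by (auto intro!: ext simp: restrict_def extensional_def)
      qed
      have "restrict f O' \<in> isos r O' s P t \<and> restrict f (A - O') \<in> isos r (A - O') s (B - P) t"
        if f: "f \<in> isos r A s B t" and "f ` O' = P" for f
      proof -
        have "f ` (A - O') = B - P"
          using inj_on_image_set_diff[OF isosD(3)[OF f], of A O'] sub isosD(4)[OF f] that(2) by auto
        then show ?thesis
          using iso_restrict_invariant[OF a f] invariant_orb[OF a O'] invariant_Diff_orb[OF a O'] that(2) by metis
      qed
      then show "(\<lambda>f. (restrict f O', restrict f (A - O'))) ` ?F P \<subseteq> isos r O' s P t \<times> isos r (A - O') s (B - P) t"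
        by blast
      have glue: "(\<lambda>x. if x \<in> O' then g x else h x) \<in> ?F P" (is "?k \<in> _")
        if g: "g \<in> isos r O' s P t" and h: "h \<in> isos r (A - O') s (B - P) t" for g h
      proof -
        have "bij_betw ?k O' P" 
          using isosD(2)[OF g] by (subst bij_betw_cong[of _ _ g]) auto
        moreover have "bij_betw ?k (A - O') (B - P)" 
          using isosD(2)[OF h] by (subst bij_betw_cong[of _ _ h]) auto
        ultimately have "bij_betw ?k (O' \<union> (A - O')) (P \<union> (B - P))" by (rule bij_betw_combine) auto
        then have bij: "bij_betw ?k A B" using sub PB by (simp add: Un_absorb1)
        have "?k (s i x) = t i (?k x)" if "i < r" "x \<in> A" for i x
          using that isosD(5)[OF g] isosD(5)[OF h] invariant_orb[OF a O'] invariant_Diff_orb[OF a O']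
          by (auto simp: invariant_def)
        moreover have "?k \<in> extensional A" using isosD(1)[OF h] sub by (auto simp: extensional_def)
        moreover have "?k ` O' = P" using isosD(4)[OF g] by auto
        ultimately show ?thesis using bij by (simp add: isos_def)
      qed
      show "(\<lambda>(g, h) x. if x \<in> O' then g x else h x) ` (isos r O' s P t \<times> isos r (A - O') s (B - P) t) \<subseteq> ?F P"
        by (intro image_subsetI, elim SigmaE) (erule ssubst, simp only: case_prod_conv, rule glue)
    qed
  qed
  also have "\<dots> = (\<Sum>P\<in>orbs r B t. card (isos r O' s P t) * card (isos r (A - O') s (B - P) t))"
    by (simp add: card_cartesian_product)
  finally show ?thesis .
qed

section \<open>Cycle types and centralizers\<close>

text \<open>A transitive action of one permutation is a single cycle. By the pigeonhole principle
  the iterates of \<open>x\<close> repeat, and injectivity shifts any repetition back to the start,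
  so the orbit closes up exactly at \<open>x\<close>.\<close>

lemma cyclic_action:
  assumes a: "fin_action (Suc 0) A s" and tr: "trans_action (Suc 0) A s" and x: "x \<in> A"
  shows "bij_betw (\<lambda>n. (s 0 ^^ n) x) {..<card A} A" "(s 0 ^^ card A) x = x"
proof -
  let ?p = "s 0"
  let ?S = "\<lambda>n. (?p ^^ n) x"
  have bij: "bij_betw ?p A A" using fin_actionD(2)[OF a, of 0] by simp
  have SA: "?S n \<in> A" for n by (induction n) (use x fin_actionD(3)[OF a, of 0] in auto)
  have cancel: "?S m = x" if "?S (n + m) = ?S n" for n m
    using that
  proof (induction n)
    case (Suc n)
    then have "?p (?S (n + m)) = ?p (?S n)" by simp
    then have "?S (n + m) = ?S n" using inj_onD[OF bij_betw_imp_inj_on[OF bij]] SA by blast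
    then show ?case by (rule Suc.IH)
  qed simp
  have "\<not> inj ?S"
  proof
    assume "inj ?S"
    moreover have "range ?S \<subseteq> A" using SA by auto
    ultimately show False using fin_actionD(1)[OF a] finite_imageD finite_subset infinite_UNIV_nat by metis
  qed
  then obtain i j where ij: "i < j" "?S i = ?S j"
    unfolding inj_def by (metis linorder_neqE_nat)
  then have ex: "0 < j - i \<and> ?S (j - i) = x" using cancel[of i "j - i"] by simp
  \<comment> \<open>The least positive period of \<open>x\<close>; it will turn out to be
    \<open>card A\<close>.\<close>
  define k where "k = (LEAST k. 0 < k \<and> ?S k = x)"
  have k: "0 < k" "?S k = x" using LeastI[of "\<lambda>k. 0 < k \<and> ?S k = x", OF ex] by (auto simp: k_def)
  have least: "?S m \<noteq> x" if "0 < m" "m < k" for m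
    using not_less_Least[of m "\<lambda>k. 0 < k \<and> ?S k = x"] that by (auto simp: k_def)
  have inj: "inj_on ?S {..<k}"
  proof (rule linorder_inj_onI)
    fix i j assume "i < j" "i \<in> {..<k}" "j \<in> {..<k}"
    then show "?S i \<noteq> ?S j" using cancel[of i "j - i"] least[of "j - i"] by auto
  qed auto
  have "y \<in> ?S ` {..<k}" if "y \<in> A" for y
  proof -
    have "(x, y) \<in> reach (Suc 0) A s" using tr x that by (auto simp: trans_action_def)
    then show ?thesis using a
    proof (induction rule: reach_induct)
      case refl then show ?case using k(1) by (auto intro!: image_eqI[of _ _ 0])
    next
      case (step y i)
      then obtain n where n: "n < k" "y = ?S n" by auto
      then have eq: "s i y = ?S (Suc n)" using step by simp
      show ?case
      proof (cases "Suc n = k")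
        case True
        then show ?thesis using eq k by (intro image_eqI[of _ _ 0]) auto
      next
        case False
        then show ?thesis using eq n by (intro image_eqI[of _ _ "Suc n"]) auto
      qed
    qed
  qed
  then have im: "?S ` {..<k} = A" using SA by blast
  then have "card A = k" using card_image[OF inj] by simp
  then show "bij_betw ?S {..<card A} A" "?S (card A) = x" using inj im k by (auto simp: bij_betw_def)
qed

text \<open>Agreement at one point spreads along the steps of the action, and these reach every
  point.\<close>

lemma isos_trans_action_eqI:
  assumes a: "fin_action r A s" and tr: "trans_action r A s"
    and f: "f \<in> isos r A s B t" and g: "g \<in> isos r A s B t" and x: "x \<in> A" "f x = g x"
  shows "f = g"
proof (rule extensionalityI[OF isosD(1)[OF f] isosD(1)[OF g]])
  fix y assume "y \<in> A"
  then have "(x, y) \<in> reach r A s" using tr x by (auto simp: trans_action_def)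
  then show "f y = g y" using a
  proof (induction rule: reach_induct)
    case refl show ?case by (rule x(2))
  next
    case (step y i)
    then show ?case using isosD(5)[OF f] isosD(5)[OF g] by simp
  qed
qed

text \<open>Evaluation at a base point \<open>x\<close> is a bijection onto \<open>B\<close>: it is
  injective by transitivity, and two cycles of equal length can be aligned so that \<open>x\<close>
  meets any prescribed \<open>y\<close>.\<close>

lemma card_isos_cyclic:
  assumes a: "fin_action (Suc 0) A s" "trans_action (Suc 0) A s"
    and b: "fin_action (Suc 0) B t" "trans_action (Suc 0) B t" and c: "card A = card B"
  shows "card (isos (Suc 0) A s B t) = card A"
proof -
  obtain x where x: "x \<in> A" using a(2) by (auto simp: trans_action_def)
  define S where "S = (\<lambda>n. (s 0 ^^ n) x)"
  have S: "bij_betw S {..<card A} A" "S (card A) = x" "S 0 = x" "\<And>n. s 0 (S n) = S (Suc n)"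
    using cyclic_action[OF a x] by (simp_all add: S_def)
  have "bij_betw (\<lambda>f. f x) (isos (Suc 0) A s B t) B"
  proof (rule bij_betwI')
    show "f x = g x \<longleftrightarrow> f = g" if "f \<in> isos (Suc 0) A s B t" "g \<in> isos (Suc 0) A s B t" for f g
      using isos_trans_action_eqI[OF a that x] by auto
    show "f x \<in> B" if "f \<in> isos (Suc 0) A s B t" for f
      using isosD(6)[OF that x] .
    fix y assume y: "y \<in> B"
    define T where "T = (\<lambda>n. (t 0 ^^ n) y)"
    have T: "bij_betw T {..<card A} B" "T (card A) = y" "T 0 = y" "\<And>n. t 0 (T n) = T (Suc n)"
      using cyclic_action[OF b y] by (simp_all add: T_def c)
    \<comment> \<open>\<open>S\<close> and \<open>T\<close> number the two cycles from
      \<open>x\<close> and from \<open>y\<close>; \<open>f\<close> matches equal positions.\<close>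
    define f where "f = T \<circ> inv_into {..<card A} S"
    have fS: "f (S n) = T n" if "n < card A" for n
      using that by (simp add: f_def inv_into_f_f[OF bij_betw_imp_inj_on[OF S(1)]])
    have pos: "0 < card A" using x fin_actionD(1)[OF a(1)] by (auto simp: card_gt_0_iff)
    have "restrict f A \<in> isos (Suc 0) A s B t"
    proof (rule isos_restrict[OF a(1)])
      show "bij_betw f A B" unfolding f_def by (rule bij_betw_trans[OF bij_betw_inv_into[OF S(1)] T(1)])
      fix i z assume i: "i < Suc 0" and z: "z \<in> A"
      then obtain n where n: "n < card A" "z = S n" using bij_betw_imp_surj_on[OF S(1)] by auto
      \<comment> \<open>Positions are only taken below \<open>card A\<close>, so the step from the
        last position has to wrap around to position 0, in both cycles at once.\<close>
      show "f (s i z) = t i (f z)"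
      proof (cases "Suc n = card A")
        case True
        then have "S (Suc n) = S 0" "T (Suc n) = T 0" using S T by auto
        then show ?thesis using i n fS[of n] fS[of 0] pos S(4)[of n] T(4)[of n] by simp
      next
        case False
        then show ?thesis using i n fS[of n] fS[of "Suc n"] S(4)[of n] T(4)[of n] by simp
      qed
    qed
    moreover have "restrict f A x = y" using fS[OF pos] S(3) T(3) x by simp
    ultimately show "\<exists>f\<in>isos (Suc 0) A s B t. y = f x" by metis
  qed
  then show ?thesis using bij_betw_same_card c by metis
qed

section \<open>Orbit sizes, which for \<open>r = 1\<close> form the cycle type, and the order of the
  centralizer\<close>

definition orb_count :: "nat \<Rightarrow> 'a set \<Rightarrow> (nat \<Rightarrow> 'a \<Rightarrow> 'a) \<Rightarrow> nat \<Rightarrow> nat" where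
  "orb_count r A s j = card {P \<in> orbs r A s. card P = j}"

lemma orb_count_Diff_orb:
  assumes a: "fin_action r A s" and P: "P \<in> orbs r A s"
  shows "orb_count r (A - P) s = (orb_count r A s)(card P := orb_count r A s (card P) - 1)"
proof
  fix j
  have "orb_count r (A - P) s j = card ({Q \<in> orbs r A s. card Q = j} - {P})"
    unfolding orb_count_def orbs_Diff_orb[OF assms] by (rule arg_cong[where f = card]) auto
  also have "\<dots> = ((orb_count r A s)(card P := orb_count r A s (card P) - 1)) j"
    using P finite_orbs[OF a] by (auto simp: orb_count_def card_Diff_singleton_if)
  finally show "orb_count r (A - P) s j = ((orb_count r A s)(card P := orb_count r A s (card P) - 1)) j" .
qed

lemma card_orb_pos: "fin_action r A s \<Longrightarrow> P \<in> orbs r A s \<Longrightarrow> 0 < card P"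
  using finite_orb orbs_nonempty by (metis card_gt_0_iff)

lemma card_orb_le: "fin_action r A s \<Longrightarrow> P \<in> orbs r A s \<Longrightarrow> card P \<le> card A"
  using orbs_subset fin_actionD(1) by (metis card_mono)

lemma card_isos_empty: "card (isos r {} s {} t) = 1"
proof -
  have "isos r {} s {} t = {\<lambda>x. undefined}" by (auto simp: isos_def extensional_def bij_betw_def)
  then show ?thesis by simp
qed

lemma orb_count_pos: "fin_action r A s \<Longrightarrow> P \<in> orbs r A s \<Longrightarrow> 0 < orb_count r A s (card P)"
  using finite_orbs[of r A s] by (auto simp: orb_count_def card_gt_0_iff)

text \<open>The factors fit the splitting at an orbit of size \<open>d\<close>: there are
  \<open>\<kappa> d\<close> orbits it can be sent to, and \<open>d\<close> isomorphisms onto each of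
  them.\<close>

lemma z_part_remove:
  assumes "1 \<le> d" "d \<le> N" "0 < \<kappa> d"
  shows "z_part N \<kappa> = \<kappa> d * (d * z_part N (\<kappa>(d := \<kappa> d - 1)))"
proof -
  have d: "d \<in> {1..N}" using assms by simp
  obtain k where k: "\<kappa> d = Suc k" using assms(3) by (cases "\<kappa> d") auto
  have "(\<Prod>j\<in>{1..N} - {d}. j ^ (\<kappa>(d := k)) j * fact ((\<kappa>(d := k)) j)) = (\<Prod>j\<in>{1..N} - {d}. j ^ \<kappa> j * fact (\<kappa> j))"
    by (rule prod.cong) auto
  then show ?thesis
    unfolding z_part_def prod.remove[OF finite_atLeastAtMost d] by (simp add: k algebra_simps)
qed

text \<open>Induction by removing one orbit \<open>P\<close> and each possible image
  \<open>Q\<close> of the same size. The bound \<open>N\<close> replaces \<open>card A\<close> so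
  that the range of the product in \<open>z_part\<close> stays fixed while the carriers shrink;
  sizes that do not occur contribute the factor 1.\<close>

lemma card_isos_eq_z_part:
  assumes "fin_action (Suc 0) A s" "fin_action (Suc 0) B t"
    and "orb_count (Suc 0) A s = \<kappa>" "orb_count (Suc 0) B t = \<kappa>" "card A \<le> N"
  shows "card (isos (Suc 0) A s B t) = z_part N \<kappa>"
  using assms
proof (induction "card A" arbitrary: A B \<kappa> rule: less_induct)
  case less
  note a = less.prems(1) and b = less.prems(2)
  show ?case
  proof (cases "orbs (Suc 0) A s = {}")
    case True
    then have A: "A = {}" and k: "\<kappa> = (\<lambda>j. 0)"
      using Union_orbs[OF a] less.prems(3) by (auto simp: orb_count_def)
    then have "orbs (Suc 0) B t = {}" using orb_count_pos[OF b] less.prems(4) by fastforce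
    then have "B = {}" using Union_orbs[OF b] by simp
    then show ?thesis using A k by (simp add: card_isos_empty z_part_def)
  next
    case False
    then obtain P where P: "P \<in> orbs (Suc 0) A s" by blast
    define d where "d = card P"
    have d: "1 \<le> d" "d \<le> N" using card_orb_pos[OF a P] card_orb_le[OF a P] less.prems(5) by (auto simp: d_def)
    have kd: "0 < \<kappa> d" using orb_count_pos[OF a P] less.prems(3) by (auto simp: d_def)
    note P' = fin_action_orb[OF a P] trans_action_orb[OF a P]
    have term_eq: "card (isos (Suc 0) P s Q t) * card (isos (Suc 0) (A - P) s (B - Q) t)
        = (if card Q = d then d * z_part N (\<kappa>(d := \<kappa> d - 1)) else 0)"
      if Q: "Q \<in> orbs (Suc 0) B t" for Q
    proof (cases "card Q = d")
      case True
      note Q' = fin_action_orb[OF b Q] trans_action_orb[OF b Q]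
      have "card (isos (Suc 0) P s Q t) = d"
        using card_isos_cyclic[OF P'(1,3) Q'(1,3)] True by (simp add: d_def)
      moreover have "card (isos (Suc 0) (A - P) s (B - Q) t) = z_part N (\<kappa>(d := \<kappa> d - 1))"
      proof (rule less.hyps[OF _ P'(2) Q'(2)])
        have "P \<subseteq> A" "P \<noteq> {}" using orbs_subset[OF a P] orbs_nonempty[OF a P] by auto
        then show "card (A - P) < card A" using fin_actionD(1)[OF a] by (intro psubset_card_mono) auto
        then show "card (A - P) \<le> N" using less.prems(5) by simp
        show "orb_count (Suc 0) (A - P) s = \<kappa>(d := \<kappa> d - 1)"
          using orb_count_Diff_orb[OF a P] less.prems(3) by (simp add: d_def)
        show "orb_count (Suc 0) (B - Q) t = \<kappa>(d := \<kappa> d - 1)"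
          using orb_count_Diff_orb[OF b Q] less.prems(4) True by simp
      qed
      ultimately show ?thesis using True by simp
    next
      case False
      then have "isos (Suc 0) P s Q t = {}" using card_isos_eq[of "Suc 0" P s Q t] by (auto simp: d_def)
      then show ?thesis using False by simp
    qed
    have "card (isos (Suc 0) A s B t) = (\<Sum>Q\<in>orbs (Suc 0) B t. if card Q = d then d * z_part N (\<kappa>(d := \<kappa> d - 1)) else 0)"
      unfolding card_isos_split_orb[OF a b P] by (rule sum.cong[OF refl term_eq])
    also have "\<dots> = card {Q \<in> orbs (Suc 0) B t. card Q = d} * (d * z_part N (\<kappa>(d := \<kappa> d - 1)))"
      by (simp add: sum.inter_filter[OF finite_orbs[OF b], symmetric])
    also have "\<dots> = z_part N \<kappa>"
      using less.prems(4) z_part_remove[of d N \<kappa>, OF d kd] by (auto simp: orb_count_def)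
    finally show ?thesis .
  qed
qed

lemma inj_on_image_orbs:
  assumes "fin_action r A s" "f \<in> isos r A s B t"
  shows "inj_on ((`) f) (orbs r A s)"
  using inj_on_image isosD(3)[OF assms(2)] Union_orbs[OF assms(1)] by metis

lemma orb_count_iso:
  assumes a: "fin_action r A s" and f: "f \<in> isos r A s B t"
  shows "orb_count r A s = orb_count r B t"
proof
  fix j
  have c: "card (f ` P) = card P" if "P \<in> orbs r A s" for P
    using card_image inj_on_subset[OF isosD(3)[OF f] orbs_subset[OF a that]] by blast
  have "{Q \<in> orbs r B t. card Q = j} = (`) f ` {P \<in> orbs r A s. card P = j}"
    using c by (auto simp: orbs_iso[OF a f])
  then show "orb_count r A s j = orb_count r B t j"
    unfolding orb_count_def
    by (simp add: card_image inj_on_subset[OF inj_on_image_orbs[OF a f]])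
qed

section \<open>Disjoint unions of transitive actions\<close>

lemma orb_mem_orbsI:
  assumes a: "fin_action r A s" and C: "invariant r A s C" and tr: "trans_action r C s"
  shows "C \<in> orbs r A s"
proof -
  obtain x where x: "x \<in> C" using tr by (auto simp: trans_action_def)
  have sub: "C \<subseteq> A" using C by (simp add: invariant_def)
  have "y \<in> C" if "(x, y) \<in> reach r A s" for y
    using that a by (induction rule: reach_induct) (use x C in \<open>auto simp: invariant_def\<close>)
  moreover have "(x, y) \<in> reach r A s" if "y \<in> C" for y
    using tr x that reach_invariant[OF a C] by (auto simp: trans_action_def)
  ultimately have "C = reach r A s `` {x}" by auto
  then show ?thesis using orbs_memI[OF a, of x] x sub by auto
qed

text \<open>The action on a disjoint union: the index in the first component keeps the summands
  apart, so the same action may occur several times.\<close>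

definition sigma_act :: "('p \<Rightarrow> nat \<Rightarrow> 'a \<Rightarrow> 'a) \<Rightarrow> nat \<Rightarrow> 'p \<times> 'a \<Rightarrow> 'p \<times> 'a" where
  "sigma_act u i px = (fst px, u (fst px) i (snd px))"

lemma fin_action_Sigma:
  assumes "finite P" "\<And>p. p \<in> P \<Longrightarrow> fin_action r (D p) (u p)"
  shows "fin_action r (Sigma P D) (sigma_act u)"
  unfolding fin_action_def
proof (intro conjI allI impI)
  show fin: "finite (Sigma P D)" using assms fin_actionD(1) by (intro finite_SigmaI) auto
  fix i assume i: "i < r"
  have "inj_on (sigma_act u i) (Sigma P D)"
  proof (rule inj_onI, clarsimp simp: sigma_act_def)
    fix p x y assume "p \<in> P" "x \<in> D p" "y \<in> D p" "u p i x = u p i y"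
    then show "x = y" using inj_onD[OF bij_betw_imp_inj_on[OF fin_actionD(2)[OF assms(2) i]]] by simp
  qed
  moreover have "sigma_act u i ` Sigma P D \<subseteq> Sigma P D"
    using fin_actionD(3)[OF assms(2) i] by (auto simp: sigma_act_def)
  ultimately show "bij_betw (sigma_act u i) (Sigma P D) (Sigma P D)"
    using endo_inj_surj[OF fin] by (simp add: bij_betw_def)
qed

lemma Pair_iso_Sigma:
  assumes "fin_action r (D p) (u p)"
  shows "restrict (Pair p) (D p) \<in> isos r (D p) (u p) ({p} \<times> D p) (sigma_act u)"
  by (rule isos_restrict[OF assms]) (auto simp: bij_betw_def inj_on_def sigma_act_def)

lemma orbs_Sigma:
  assumes P: "finite P" and D: "\<And>p. p \<in> P \<Longrightarrow> fin_action r (D p) (u p)"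
    and tr: "\<And>p. p \<in> P \<Longrightarrow> trans_action r (D p) (u p)"
  shows "orbs r (Sigma P D) (sigma_act u) = (\<lambda>p. {p} \<times> D p) ` P"
proof -
  have a: "fin_action r (Sigma P D) (sigma_act u)" by (rule fin_action_Sigma[OF P D])
  have mem: "{p} \<times> D p \<in> orbs r (Sigma P D) (sigma_act u)" if p: "p \<in> P" for p
  proof (rule orb_mem_orbsI[OF a])
    show "invariant r (Sigma P D) (sigma_act u) ({p} \<times> D p)"
      using p fin_actionD(3)[OF D[OF p]] by (auto simp: invariant_def sigma_act_def)
    show "trans_action r ({p} \<times> D p) (sigma_act u)"
      by (rule trans_action_iso[OF D[OF p] Pair_iso_Sigma[of r D p u, OF D[OF p]] tr[OF p]])
  qed
  show ?thesis
  proof (intro equalityI subsetI)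
    fix Q assume Q: "Q \<in> orbs r (Sigma P D) (sigma_act u)"
    then obtain p x where px: "(p, x) \<in> Q" using orbs_nonempty[OF a] by fast
    then have p: "p \<in> P" "x \<in> D p" using orbs_subset[OF a Q] by auto
    then have "Q = {p} \<times> D p" using orbs_disjoint[OF a Q mem[OF p(1)]] px by auto
    then show "Q \<in> (\<lambda>p. {p} \<times> D p) ` P" using p by simp
  qed (use mem in auto)
qed

section \<open>Isomorphism types and tuples of permutations\<close>

lemma perm_tuples_iff: "gs \<in> perm_tuples r m \<longleftrightarrow> length gs = r \<and> (\<forall>i<r. gs ! i permutes {1..m})"
  by (auto simp: perm_tuples_def subset_iff in_set_conv_nth sym_group_carrier)

lemma fin_action_perm_tuple: "gs \<in> perm_tuples r m \<Longrightarrow> fin_action r {1..m} (nth gs)"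
  by (auto simp: fin_action_def perm_tuples_iff intro: permutes_imp_bij)

lemma finite_perm_tuples: "finite (perm_tuples r m)"
proof -
  have "finite (carrier (sym_group m))" by (simp add: sym_group_def finite_permutations)
  then show ?thesis 
    using finite_lists_length_eq[of _ r] by (simp add: perm_tuples_def conj_commute)
qed

lemma ex_isomorphic_perm_tuple:
  assumes a: "fin_action r A s"
  shows "\<exists>gs\<in>perm_tuples r (card A). isos r A s {1..card A} (nth gs) \<noteq> {}"
proof -
  define B where "B = {1..card A}"
  have "\<exists>f. bij_betw f A B"
    by (rule finite_same_card_bij[OF fin_actionD(1)[OF a]]) (simp_all add: B_def)
  then obtain f where f: "bij_betw f A B" ..
  \<comment> \<open>The action transported along \<open>f\<close>, extended by the identity because
    \<open>permutes\<close> asks for fixed points outside \<open>B\<close>.\<close>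
  define g where "g i x = (if x \<in> B then f (s i (inv_into A f x)) else x)" for i x
  define gs where "gs = map g [0..<r]"
  have gs: "gs ! i = g i" if "i < r" for i using that by (simp add: gs_def)
  have "g i permutes B" if i: "i < r" for i
  proof (rule bij_imp_permutes)
    have "bij_betw (f \<circ> s i \<circ> inv_into A f) B B"
      using bij_betw_trans[OF bij_betw_inv_into[OF f] bij_betw_trans[OF fin_actionD(2)[OF a i] f]]
      by (simp add: comp_assoc)
    then show "bij_betw (g i) B B" by (subst bij_betw_cong[of _ _ "f \<circ> s i \<circ> inv_into A f"]) (auto simp: g_def)
  qed (simp add: g_def)
  then have "gs \<in> perm_tuples r (card A)" by (simp add: perm_tuples_iff gs B_def) (simp add: gs_def)
  moreover have "restrict f A \<in> isos r A s B (nth gs)"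
  proof (rule isos_restrict[OF a f])
    fix i x assume i: "i < r" and x: "x \<in> A"
    have "f x \<in> B" using bij_betwE[OF f] x by simp
    then show "f (s i x) = (gs ! i) (f x)"
      using i x by (simp add: gs g_def inv_into_f_f[OF bij_betw_imp_inj_on[OF f]])
  qed
  ultimately show ?thesis unfolding B_def by blast
qed

text \<open>The isomorphism type of an action: its size and the conjugacy class of tuples in
  \<open>perm_tuples\<close> that are isomorphic to it. The size is recorded separately because a
  permutation of \<open>{1..d}\<close> is also one of any larger interval.\<close>
definition orb_type :: "nat \<Rightarrow> 'a set \<Rightarrow> (nat \<Rightarrow> 'a \<Rightarrow> 'a) \<Rightarrow> nat \<times> (nat \<Rightarrow> nat) list set" where
  "orb_type r A s = (card A, {gs \<in> perm_tuples r (card A). isos r A s {1..card A} (nth gs) \<noteq> {}})"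

lemma orb_type_iso:
  assumes a: "fin_action r A s" and b: "fin_action r B t" and f: "f \<in> isos r A s B t"
  shows "orb_type r A s = orb_type r B t"
proof -
  have "card A = card B" using card_isos_eq[of r A s B t] f by blast
  moreover have "isos r A s C u \<noteq> {} \<longleftrightarrow> isos r B t C u \<noteq> {}" for C :: "nat set" and u
    using isos_compose[OF b isos_inverse[OF a b f], of _ C u] isos_compose[OF a f, of _ C u] by blast
  ultimately show ?thesis by (simp add: orb_type_def)
qed

text \<open>A type is never empty in its second component, so equal types share a tuple, and the
  isomorphisms to that tuple compose to one from \<open>A\<close> to \<open>B\<close>.\<close>

lemma orb_type_eq_iff:
  assumes a: "fin_action r A s" and b: "fin_action r B t"
  shows "orb_type r A s = orb_type r B t \<longleftrightarrow> isos r A s B t \<noteq> {}"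
proof
  assume eq: "orb_type r A s = orb_type r B t"
  obtain gs f where gs: "gs \<in> perm_tuples r (card A)" and f: "f \<in> isos r A s {1..card A} (nth gs)"
    using ex_isomorphic_perm_tuple[OF a] by blast
  then have "gs \<in> snd (orb_type r A s)" by (auto simp: orb_type_def)
  then have "gs \<in> snd (orb_type r B t)" by (simp add: eq)
  moreover have "card A = card B" using eq by (simp add: orb_type_def)
  ultimately obtain g where g: "g \<in> isos r B t {1..card A} (nth gs)" by (auto simp: orb_type_def)
  show "isos r A s B t \<noteq> {}"
    using isos_compose[OF a f isos_inverse[OF b fin_action_perm_tuple[OF gs] g]] by blast
qed (use orb_type_iso[OF a b] in blast)

section \<open>The multiset of orbit types as a complete invariant\<close>

definition orbit_mset :: "nat \<Rightarrow> 'a set \<Rightarrow> (nat \<Rightarrow> 'a \<Rightarrow> 'a) \<Rightarrow> (nat \<times> (nat \<Rightarrow> nat) list set) multiset" where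
  "orbit_mset r A s = image_mset (\<lambda>P. orb_type r P s) (mset_set (orbs r A s))"

lemma orbit_mset_iso:
  assumes a: "fin_action r A s" and b: "fin_action r B t" and f: "f \<in> isos r A s B t"
  shows "orbit_mset r A s = orbit_mset r B t"
proof -
  have eq: "orb_type r P s = orb_type r (f ` P) t" if P: "P \<in> orbs r A s" for P
  proof (rule orb_type_iso[OF _ _ iso_restrict_invariant[OF a f invariant_orb[OF a P]]])
    show "fin_action r P s" "fin_action r (f ` P) t"
      using fin_action_orb(1)[OF a P] fin_action_orb(1)[OF b, of "f ` P"] P orbs_iso[OF a f] by auto
  qed
  have "orbit_mset r B t = image_mset (\<lambda>P. orb_type r (f ` P) t) (mset_set (orbs r A s))"
    by (simp add: orbit_mset_def orbs_iso[OF a f] image_mset_mset_set[OF inj_on_image_orbs[OF a f], symmetric]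
      multiset.map_comp comp_def)
  moreover have "orbit_mset r A s = image_mset (\<lambda>P. orb_type r (f ` P) t) (mset_set (orbs r A s))"
    unfolding orbit_mset_def by (rule image_mset_cong) (use eq finite_orbs[OF a] in simp)
  ultimately show ?thesis by simp
qed

lemma orbit_mset_Diff_orb:
  assumes a: "fin_action r A s" and P: "P \<in> orbs r A s"
  shows "orbit_mset r A s = add_mset (orb_type r P s) (orbit_mset r (A - P) s)"
  using finite_orbs[OF a] P unfolding orbit_mset_def orbs_Diff_orb[OF assms]
  by (subst mset_set.remove[of _ P]) auto

lemma isos_nonempty_iff_card: "fin_action r A s \<Longrightarrow> fin_action r B t \<Longrightarrow> isos r A s B t \<noteq> {} \<longleftrightarrow> card (isos r A s B t) \<noteq> 0"
  using finite_isos[of r A s B t] fin_actionD(1)[of r B t] by auto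

text \<open>An orbit \<open>P\<close> of \<open>A\<close> has a partner \<open>Q\<close> of the same
  type in \<open>B\<close>, and the complements are isomorphic by induction. The product of the two
  counts is then a nonzero summand in \<open>card_isos_split_orb\<close>.\<close>

lemma orbit_mset_eq_imp:
  assumes "fin_action r A s" "fin_action r B t" "orbit_mset r A s = orbit_mset r B t"
  shows "isos r A s B t \<noteq> {}"
  using assms
proof (induction "card A" arbitrary: A B rule: less_induct)
  case less
  note a = less.prems(1) and b = less.prems(2)
  show ?case
  proof (cases "orbs r A s = {}")
    case True
    then have "orbs r B t = {}" using less.prems(3) finite_orbs[OF b] by (simp add: orbit_mset_def mset_set_empty_iff)
    then have "A = {}" "B = {}" using True Union_orbs[OF a] Union_orbs[OF b] by auto
    then show ?thesis using card_isos_empty[of r s t] by auto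
  next
    case False
    then obtain P where P: "P \<in> orbs r A s" by blast
    have "orb_type r P s \<in># orbit_mset r B t"
      using orbit_mset_Diff_orb[OF a P] less.prems(3) by (metis union_single_eq_member)
    then obtain Q where Q: "Q \<in> orbs r B t" "orb_type r P s = orb_type r Q t"
      using finite_orbs[OF b] by (auto simp: orbit_mset_def)
    note P' = fin_action_orb[OF a P] and Q' = fin_action_orb[OF b Q(1)]
    have 1: "isos r P s Q t \<noteq> {}" using Q(2) orb_type_eq_iff[OF P'(1) Q'(1)] by simp
    have 2: "isos r (A - P) s (B - Q) t \<noteq> {}"
    proof (rule less.hyps[OF _ P'(2) Q'(2)])
      have "P \<subseteq> A" "P \<noteq> {}" using orbs_subset[OF a P] orbs_nonempty[OF a P] by auto
      then show "card (A - P) < card A" using fin_actionD(1)[OF a] by (intro psubset_card_mono) auto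
      show "orbit_mset r (A - P) s = orbit_mset r (B - Q) t"
        using orbit_mset_Diff_orb[OF a P] orbit_mset_Diff_orb[OF b Q(1)] less.prems(3) Q(2) by simp
    qed
    have "card (isos r P s Q t) * card (isos r (A - P) s (B - Q) t) \<noteq> 0"
      using 1 2 isos_nonempty_iff_card[OF P'(1) Q'(1)] isos_nonempty_iff_card[OF P'(2) Q'(2)] by simp
    then have "card (isos r A s B t) \<noteq> 0"
      unfolding card_isos_split_orb[OF a b P] using Q(1) finite_orbs[OF b] by (auto simp: sum_eq_0_iff)
    then show ?thesis by (metis card.empty)
  qed
qed

text \<open>A definition cannot range over all carrier types. Fixing \<open>nat\<close> loses no
  type, since every finite action has a copy on an interval \<open>{1..n}\<close>; see
  \<open>orb_type_in_trans_types\<close>.\<close>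

definition trans_types :: "nat \<Rightarrow> (nat \<times> (nat \<Rightarrow> nat) list set) set" where
  "trans_types r = {orb_type r A s | (A :: nat set) s. fin_action r A s \<and> trans_action r A s}"

lemma orb_type_in_trans_types:
  assumes a: "fin_action r A s" and tr: "trans_action r A s"
  shows "orb_type r A s \<in> trans_types r"
proof -
  obtain gs f where gs: "gs \<in> perm_tuples r (card A)" and f: "f \<in> isos r A s {1..card A} (nth gs)"
    using ex_isomorphic_perm_tuple[OF a] by blast
  note b = fin_action_perm_tuple[OF gs]
  show ?thesis unfolding trans_types_def
    using orb_type_iso[OF a b f] trans_action_iso[OF a f tr] b by blast
qed

lemma orbit_mset_in_trans_types:
  assumes a: "fin_action r A s"
  shows "set_mset (orbit_mset r A s) \<subseteq> trans_types r"
  using finite_orbs[OF a] orb_type_in_trans_types[OF fin_action_orb(1)[OF a] trans_action_orb[OF a]]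
  by (auto simp: orbit_mset_def)

lemma sum_card_orbs:
  assumes a: "fin_action r A s"
  shows "(\<Sum>P\<in>orbs r A s. card P) = card A"
proof -
  have "card (\<Union> (orbs r A s)) = (\<Sum>P\<in>orbs r A s. card P)"
    by (rule card_Union_disjoint)
      (use orbs_disjoint[OF a] finite_orb[OF a] in \<open>auto simp: pairwise_def disjnt_def\<close>)
  then show ?thesis by (simp add: Union_orbs[OF a])
qed

lemma weight_orbit_mset:
  assumes a: "fin_action r A s"
  shows "(\<Sum>x\<in>#orbit_mset r A s. fst x) = card A"
  by (simp add: orbit_mset_def orb_type_def multiset.map_comp comp_def sum_unfold_sum_mset[symmetric] sum_card_orbs[OF a])

text \<open>Every admissible multiset occurs: take the disjoint union of representatives of its
  elements and carry it to \<open>{1..m}\<close>, which has the right size by the weight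
  condition.\<close>

lemma ex_perm_tuple_orbit_mset:
  assumes M: "set_mset M \<subseteq> trans_types r" and m: "(\<Sum>x\<in>#M. fst x) = m"
  shows "\<exists>gs\<in>perm_tuples r m. orbit_mset r {1..m} (nth gs) = M"
proof -
  \<comment> \<open>The positions of the list serve as indices of the disjoint union, so a type of
    multiplicity \<open>c\<close> receives \<open>c\<close> separate copies.\<close>
  obtain xs where xs: "mset xs = M" using ex_mset by blast
  have "\<exists>(A :: nat set) s. fin_action r A s \<and> trans_action r A s \<and> orb_type r A s = xs ! p" if "p < length xs" for p
    using M nth_mem[OF that] xs unfolding trans_types_def by fastforce
  then obtain D :: "nat \<Rightarrow> nat set" and u where
    D: "\<And>p. p < length xs \<Longrightarrow> fin_action r (D p) (u p) \<and> trans_action r (D p) (u p) \<and> orb_type r (D p) (u p) = xs ! p"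
    by metis
  define P where "P = {..<length xs}"
  define A where "A = Sigma P D"
  have a: "fin_action r A (sigma_act u)" unfolding A_def
    by (rule fin_action_Sigma) (use D in \<open>auto simp: P_def\<close>)
  have orbs: "orbs r A (sigma_act u) = (\<lambda>p. {p} \<times> D p) ` P" unfolding A_def
    by (rule orbs_Sigma) (use D in \<open>auto simp: P_def\<close>)
  have ne: "D p \<noteq> {}" if "p \<in> P" for p using D that by (auto simp: P_def trans_action_def)
  have inj: "inj_on (\<lambda>p. {p} \<times> D p) P" using ne by (auto simp: inj_on_def times_eq_iff)
  have ty: "orb_type r ({p} \<times> D p) (sigma_act u) = xs ! p" if "p \<in> P" for p
  proof -
    have Dp: "fin_action r (D p) (u p)" "orb_type r (D p) (u p) = xs ! p" using D that by (auto simp: P_def)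
    have "fin_action r ({p} \<times> D p) (sigma_act u)"
      by (rule fin_action_iso[OF Dp(1) Pair_iso_Sigma[of r D p u, OF Dp(1)]])
    from orb_type_iso[OF Dp(1) this Pair_iso_Sigma[of r D p u, OF Dp(1)]] Dp(2) show ?thesis by simp
  qed
  have "orbit_mset r A (sigma_act u) = image_mset (\<lambda>p. xs ! p) (mset_set P)"
    unfolding orbit_mset_def orbs image_mset_mset_set[OF inj, symmetric]
    by (simp add: multiset.map_comp comp_def) (rule image_mset_cong, use ty in \<open>auto simp: P_def\<close>)
  also have "\<dots> = mset (map (nth xs) [0..<length xs])"
    by (simp add: P_def atLeast_upt)
  also have "\<dots> = M" using xs by (simp add: map_nth)
  finally have AM: "orbit_mset r A (sigma_act u) = M" .
  then have cA: "card A = m" using weight_orbit_mset[OF a] m by simp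
  obtain gs f where gs: "gs \<in> perm_tuples r m" and f: "f \<in> isos r A (sigma_act u) {1..m} (nth gs)"
    using ex_isomorphic_perm_tuple[OF a] cA by blast
  then show ?thesis using orbit_mset_iso[OF a fin_action_perm_tuple[OF gs] f] AM by (intro bexI[OF _ gs]) simp
qed

section \<open>Conjugacy and transitivity of tuples in terms of actions\<close>

lemma isos_perm_tuple_bij:
  assumes gs: "gs \<in> perm_tuples r m" and hs: "hs \<in> perm_tuples r m"
  shows "bij_betw (\<lambda>\<sigma>. restrict \<sigma> {1..m}) {\<sigma>. \<sigma> permutes {1..m} \<and> (\<forall>i<r. \<sigma> \<circ> gs ! i = hs ! i \<circ> \<sigma>)}
    (isos r {1..m} (nth gs) {1..m} (nth hs))"
proof (rule bij_betw_byWitness[where f' = "\<lambda>f x. if x \<in> {1..m} then f x else x"])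
  \<comment> \<open>A permutation is the identity outside \<open>{1..m}\<close>, an element of
    \<open>isos\<close> is \<open>undefined\<close> there; the two maps exchange these
    conventions.\<close>
  let ?A = "{1..m}"
  let ?L = "{\<sigma>. \<sigma> permutes ?A \<and> (\<forall>i<r. \<sigma> \<circ> gs ! i = hs ! i \<circ> \<sigma>)}"
  let ?R = "isos r ?A (nth gs) ?A (nth hs)"
  show "\<forall>\<sigma>\<in>?L. (\<lambda>x. if x \<in> ?A then restrict \<sigma> ?A x else x) = \<sigma>"
    by (auto simp: permutes_def)
  show "\<forall>f\<in>?R. restrict (\<lambda>x. if x \<in> ?A then f x else x) ?A = f"
    by (auto simp: isos_def extensional_def)
  show "(\<lambda>\<sigma>. restrict \<sigma> ?A) ` ?L \<subseteq> ?R"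
  proof (rule image_subsetI)
    fix \<sigma> assume "\<sigma> \<in> ?L"
    then show "restrict \<sigma> ?A \<in> ?R"
      by (intro isos_restrict[OF fin_action_perm_tuple[OF gs]] permutes_imp_bij) (auto simp: fun_eq_iff)
  qed
  show "(\<lambda>f x. if x \<in> ?A then f x else x) ` ?R \<subseteq> ?L"
  proof (rule image_subsetI)
    fix f assume f: "f \<in> ?R"
    let ?\<sigma> = "\<lambda>x. if x \<in> ?A then f x else x"
    have "bij_betw ?\<sigma> ?A ?A" using isosD(2)[OF f] by (subst bij_betw_cong[of _ _ f]) auto
    then have 1: "?\<sigma> permutes ?A" by (rule bij_imp_permutes) auto
    have "(?\<sigma> \<circ> gs ! i) x = (hs ! i \<circ> ?\<sigma>) x" if i: "i < r" for i x
    proof (cases "x \<in> ?A")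
      case True
      then show ?thesis using isosD(5)[OF f i True] fin_actionD(3)[OF fin_action_perm_tuple[OF gs] i True] by simp
    next
      case False
      have "gs ! i permutes ?A" "hs ! i permutes ?A" using gs hs i by (auto simp: perm_tuples_iff)
      from permutes_not_in[OF this(1) False] permutes_not_in[OF this(2) False] False show ?thesis by (auto split: if_splits)
    qed
    then have "\<forall>i<r. ?\<sigma> \<circ> gs ! i = hs ! i \<circ> ?\<sigma>" by (intro allI impI ext)
    then show "?\<sigma> \<in> ?L" using 1 by blast
  qed
qed

text \<open>Multiplying by \<sigma> on the right rids the conjugation of its inverse and leaves
  \<open>\<sigma> \<circ> g = h \<circ> \<sigma>\<close>, the compatibility condition in
  \<open>isos\<close>.\<close>

lemma sim_conj_iff:
  assumes gs: "gs \<in> perm_tuples r m"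
  shows "(gs, hs) \<in> sim_conj m \<longleftrightarrow> hs \<in> perm_tuples r m \<and> isos r {1..m} (nth gs) {1..m} (nth hs) \<noteq> {}"
proof -
  interpret group "sym_group m" by (rule sym_group_is_group)
  have p: "gs ! i permutes {1..m}" if "i < r" for i
    using gs that by (simp add: perm_tuples_iff)
  have len: "length gs = r" using gs by (auto simp: perm_tuples_iff)
  have conj: "h = \<sigma> \<otimes>\<^bsub>sym_group m\<^esub> g \<otimes>\<^bsub>sym_group m\<^esub> inv\<^bsub>sym_group m\<^esub> \<sigma> \<longleftrightarrow> \<sigma> \<circ> g = h \<circ> \<sigma>"
    if "\<sigma> permutes {1..m}" "g permutes {1..m}" "h permutes {1..m}" for \<sigma> g h
  proof -
    have "\<sigma> \<in> carrier (sym_group m)" "g \<in> carrier (sym_group m)" "h \<in> carrier (sym_group m)"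
      using that by (auto simp: sym_group_carrier)
    then have "h = \<sigma> \<otimes>\<^bsub>sym_group m\<^esub> g \<otimes>\<^bsub>sym_group m\<^esub> inv\<^bsub>sym_group m\<^esub> \<sigma> \<longleftrightarrow>
      h \<otimes>\<^bsub>sym_group m\<^esub> \<sigma> = \<sigma> \<otimes>\<^bsub>sym_group m\<^esub> g"
      by (metis inv_closed m_assoc m_closed l_inv r_inv r_one)
    then show ?thesis by (auto simp: sym_group_mult)
  qed
  have nonempty: "isos r {1..m} (nth gs) {1..m} (nth hs) \<noteq> {} \<longleftrightarrow>
    (\<exists>\<sigma>. \<sigma> permutes {1..m} \<and> (\<forall>i<r. \<sigma> \<circ> gs ! i = hs ! i \<circ> \<sigma>))" if "hs \<in> perm_tuples r m"
    using bij_betw_imp_surj_on[OF isos_perm_tuple_bij[OF gs that]] by (auto simp flip: ex_in_conv)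
  show ?thesis
  proof
    assume "(gs, hs) \<in> sim_conj m"
    then obtain \<sigma> where \<sigma>: "\<sigma> \<in> carrier (sym_group m)"
      "hs = map (\<lambda>g. \<sigma> \<otimes>\<^bsub>sym_group m\<^esub> g \<otimes>\<^bsub>sym_group m\<^esub> inv\<^bsub>sym_group m\<^esub> \<sigma>) gs"
      by (auto simp: sim_conj_def)
    have hs: "hs \<in> perm_tuples r m"
      using gs \<sigma> by (auto simp: perm_tuples_def simp del: sym_group_inv_equality)
    have "\<sigma> \<circ> gs ! i = hs ! i \<circ> \<sigma>" if "i < r" for i
      using conj[of \<sigma> "gs ! i" "hs ! i"] \<sigma> hs p that len by (auto simp: perm_tuples_iff sym_group_carrier)
    then show "hs \<in> perm_tuples r m \<and> isos r {1..m} (nth gs) {1..m} (nth hs) \<noteq> {}"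
      using hs nonempty \<sigma>(1) by (auto simp: sym_group_carrier)
  next
    assume "hs \<in> perm_tuples r m \<and> isos r {1..m} (nth gs) {1..m} (nth hs) \<noteq> {}"
    then obtain \<sigma> where hs: "hs \<in> perm_tuples r m" and \<sigma>: "\<sigma> permutes {1..m}" "\<forall>i<r. \<sigma> \<circ> gs ! i = hs ! i \<circ> \<sigma>"
      using nonempty by blast
    have "hs = map (\<lambda>g. \<sigma> \<otimes>\<^bsub>sym_group m\<^esub> g \<otimes>\<^bsub>sym_group m\<^esub> inv\<^bsub>sym_group m\<^esub> \<sigma>) gs"
    proof (rule nth_equalityI)
      show "length hs = length (map (\<lambda>g. \<sigma> \<otimes>\<^bsub>sym_group m\<^esub> g \<otimes>\<^bsub>sym_group m\<^esub> inv\<^bsub>sym_group m\<^esub> \<sigma>) gs)"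
        using hs len by (simp add: perm_tuples_iff)
      fix i assume "i < length hs"
      then have i: "i < r" using hs by (simp add: perm_tuples_iff)
      have "hs ! i permutes {1..m}" using hs i by (simp add: perm_tuples_iff)
      from conj[OF \<sigma>(1) p[OF i] this] \<sigma>(2) i len
      show "hs ! i = map (\<lambda>g. \<sigma> \<otimes>\<^bsub>sym_group m\<^esub> g \<otimes>\<^bsub>sym_group m\<^esub> inv\<^bsub>sym_group m\<^esub> \<sigma>) gs ! i" by simp
    qed
    then show "(gs, hs) \<in> sim_conj m" using \<sigma>(1) by (auto simp: sim_conj_def sym_group_carrier)
  qed
qed

text \<open>Elements of the generated group move points only within their reachability classes;
  conversely the steps of a path multiply, later ones on the left, to a group element. The bound on
  \<open>m\<close> is there because \<open>trans_action\<close> demands a nonempty carrier.\<close>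

lemma transitive_tuple_iff:
  assumes gs: "gs \<in> perm_tuples r m" and m: "m \<ge> 1"
  shows "transitive_tuple m gs \<longleftrightarrow> trans_action r {1..m} (nth gs)"
proof -
  interpret group "sym_group m" by (rule sym_group_is_group)
  have a: "fin_action r {1..m} (nth gs)" by (rule fin_action_perm_tuple[OF gs])
  have set: "g \<in> set gs \<longleftrightarrow> (\<exists>i<r. g = gs ! i)" for g
    using gs by (auto simp: perm_tuples_iff in_set_conv_nth)
  have 1: "\<forall>x\<in>{1..m}. (x, h x) \<in> reach r {1..m} (nth gs)" if "h \<in> generate (sym_group m) (set gs)" for h
    using that
  proof (induction rule: generate.induct)
    case one then show ?case by (auto simp: sym_group_one intro: reach_refl)
  next
    case (incl h) then show ?case using reach_step[OF a] by (auto simp: set)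
  next
    case (inv h)
    then obtain i where i: "i < r" "h = gs ! i" by (auto simp: set)
    have hc: "h permutes {1..m}" using i gs by (simp add: perm_tuples_iff)
    have inv: "inv\<^bsub>sym_group m\<^esub> h permutes {1..m}"
      using inv_closed[of h] hc by (simp add: sym_group_carrier)
    have "h ((inv\<^bsub>sym_group m\<^esub> h) x) = x" for x
      using r_inv[of h] hc by (simp add: sym_group_carrier sym_group_mult sym_group_one fun_eq_iff)
    \<comment> \<open>The generator leads from the inverse image of \<open>x\<close> to
      \<open>x\<close>, so this pair is a reversed step.\<close>
    then have "(x, (inv\<^bsub>sym_group m\<^esub> h) x) \<in> reach r {1..m} (nth gs)" if "x \<in> {1..m}" for x
      using reach_back[OF a i(1), of "(inv\<^bsub>sym_group m\<^esub> h) x"] that permutes_in_image[OF inv, of x] i(2) by simp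
    then show ?case by blast
  next
    case (eng h1 h2)
    show ?case
    proof
      fix x assume x: "x \<in> {1..m}"
      have xh: "(x, h2 x) \<in> reach r {1..m} (nth gs)" using eng x by blast
      then have "h2 x \<in> {1..m}" by (auto dest: reach_in)
      then have "(h2 x, h1 (h2 x)) \<in> reach r {1..m} (nth gs)" using eng by blast
      then show "(x, (h1 \<otimes>\<^bsub>sym_group m\<^esub> h2) x) \<in> reach r {1..m} (nth gs)"
        using reach_trans[OF xh] by (simp add: sym_group_mult)
    qed
  qed
  have 2: "\<exists>h\<in>generate (sym_group m) (set gs). h x = y" if "(x, y) \<in> reach r {1..m} (nth gs)" for x y
    using that a
  proof (induction rule: reach_induct)
    case refl show ?case by (rule bexI[OF _ generate.one]) (simp add: sym_group_one)
  next
    case (step y i)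
    then obtain h where h: "h \<in> generate (sym_group m) (set gs)" "h x = y" by blast
    have "gs ! i \<in> generate (sym_group m) (set gs)" using step.hyps(3) set by (auto intro: generate.incl)
    then have "gs ! i \<otimes>\<^bsub>sym_group m\<^esub> h \<in> generate (sym_group m) (set gs)" using h(1) by (rule generate.eng)
    then show ?case using h(2) by (intro bexI[of _ "gs ! i \<otimes>\<^bsub>sym_group m\<^esub> h"]) (simp_all add: sym_group_mult)
  qed
  show ?thesis
  proof
    assume tr: "transitive_tuple m gs"
    have "(x, y) \<in> reach r {1..m} (nth gs)" if x: "x \<in> {1..m}" and y: "y \<in> {1..m}" for x y
    proof -
      obtain h where h: "h \<in> generate (sym_group m) (set gs)" "h x = y"
        using tr x y unfolding transitive_tuple_def by blast
      show ?thesis using 1[OF h(1)] x h(2) by blast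
    qed
    then show "trans_action r {1..m} (nth gs)" using m by (simp add: trans_action_def)
  next
    assume "trans_action r {1..m} (nth gs)"
    then show "transitive_tuple m gs"
      unfolding transitive_tuple_def trans_action_def by (auto intro!: 2)
  qed
qed

section \<open>Counting conjugacy classes\<close>

text \<open>\<open>sim_conj\<close> relates arbitrary lists, beyond the set that is divided by it.
  Its classes are therefore identified with the fibres of an invariant and counted by the values of
  that invariant.\<close>

lemma card_quotient_eq_card_image:
  assumes "\<And>x. x \<in> A \<Longrightarrow> R `` {x} = {y \<in> A. f y = f x}"
  shows "card (A // R) = card (f ` A)"
proof -
  have "A // R = (\<lambda>v. {y \<in> A. f y = v}) ` f ` A"
    using assms by (auto simp: quotient_def)
  moreover have "inj_on (\<lambda>v. {y \<in> A. f y = v}) (f ` A)" by (rule inj_onI) auto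
  ultimately show ?thesis by (simp add: card_image)
qed

lemma num_transitive_classes_eq:
  assumes d: "d \<ge> 1"
  shows "num_transitive_classes r d = card {\<tau> \<in> trans_types r. fst \<tau> = d}"
proof -
  let ?T = "{gs \<in> perm_tuples r d. transitive_tuple d gs}"
  let ?f = "\<lambda>gs. orb_type r {1..d} (nth gs)"
  have T: "gs \<in> ?T \<longleftrightarrow> gs \<in> perm_tuples r d \<and> trans_action r {1..d} (nth gs)" for gs
    using transitive_tuple_iff[OF _ d] by blast
  have "card (?T // sim_conj d) = card (?f ` ?T)"
  proof (rule card_quotient_eq_card_image)
    fix gs assume "gs \<in> ?T"
    then have gs: "gs \<in> perm_tuples r d" "trans_action r {1..d} (nth gs)" using T by auto
    note a = fin_action_perm_tuple[OF gs(1)]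
    show "sim_conj d `` {gs} = {hs \<in> ?T. ?f hs = ?f gs}"
    proof (intro Set.set_eqI iffI)
      fix hs assume "hs \<in> sim_conj d `` {gs}"
      then obtain f where hs: "hs \<in> perm_tuples r d" and f: "f \<in> isos r {1..d} (nth gs) {1..d} (nth hs)"
        using sim_conj_iff[OF gs(1)] by auto
      have "?f gs = ?f hs" by (rule orb_type_iso[OF a fin_action_perm_tuple[OF hs] f])
      moreover have "hs \<in> ?T" using T hs trans_action_iso[OF a f gs(2)] by simp
      ultimately show "hs \<in> {hs \<in> ?T. ?f hs = ?f gs}" by simp
    next
      fix hs assume "hs \<in> {hs \<in> ?T. ?f hs = ?f gs}"
      then have hs: "hs \<in> perm_tuples r d" "?f gs = ?f hs" by auto
      then have "isos r {1..d} (nth gs) {1..d} (nth hs) \<noteq> {}"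
        using orb_type_eq_iff[OF a fin_action_perm_tuple[OF hs(1)]] by simp
      then show "hs \<in> sim_conj d `` {gs}" using sim_conj_iff[OF gs(1)] hs(1) by simp
    qed
  qed
  also have "?f ` ?T = {\<tau> \<in> trans_types r. fst \<tau> = d}"
  proof (intro equalityI subsetI)
    fix \<tau> assume "\<tau> \<in> ?f ` ?T"
    then obtain gs where gs: "gs \<in> ?T" "\<tau> = ?f gs" by (rule imageE)
    then show "\<tau> \<in> {\<tau> \<in> trans_types r. fst \<tau> = d}"
      using T orb_type_in_trans_types[OF fin_action_perm_tuple] by (simp add: orb_type_def)
  next
    fix \<tau> assume "\<tau> \<in> {\<tau> \<in> trans_types r. fst \<tau> = d}"
    then obtain A :: "nat set" and s where A: "fin_action r A s" "trans_action r A s" "\<tau> = orb_type r A s" "card A = d"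
      by (auto simp: trans_types_def orb_type_def)
    obtain gs f where gs: "gs \<in> perm_tuples r d" and f: "f \<in> isos r A s {1..d} (nth gs)"
      using ex_isomorphic_perm_tuple[OF A(1)] A(4) by auto
    have "\<tau> = ?f gs" unfolding A(3) by (rule orb_type_iso[OF A(1) fin_action_perm_tuple[OF gs] f])
    moreover have "gs \<in> ?T" using T gs trans_action_iso[OF A(1) f A(2)] by simp
    ultimately show "\<tau> \<in> ?f ` ?T" by (rule image_eqI)
  qed
  finally show ?thesis by (simp add: num_transitive_classes_def)
qed

definition weighted_msets :: "('a \<Rightarrow> nat) \<Rightarrow> 'a set \<Rightarrow> nat \<Rightarrow> 'a multiset set" where
  "weighted_msets w T m = {M. set_mset M \<subseteq> T \<and> (\<Sum>x\<in>#M. w x) = m}"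

text \<open>Since \<open>orbit_mset\<close> separates exactly the conjugacy classes, the number of
  all classes on \<open>m\<close> points becomes a number of multisets, free of
  permutations.\<close>

lemma image_orbit_mset_perm_tuples:
  "(\<lambda>gs. orbit_mset r {1..m} (nth gs)) ` perm_tuples r m = weighted_msets fst (trans_types r) m"
proof (intro equalityI subsetI)
  fix M assume "M \<in> (\<lambda>gs. orbit_mset r {1..m} (nth gs)) ` perm_tuples r m"
  then obtain gs where gs: "gs \<in> perm_tuples r m" "M = orbit_mset r {1..m} (nth gs)" by blast
  then show "M \<in> weighted_msets fst (trans_types r) m"
    using orbit_mset_in_trans_types[OF fin_action_perm_tuple[OF gs(1)]] weight_orbit_mset[OF fin_action_perm_tuple[OF gs(1)]]
    by (simp add: weighted_msets_def)
next
  fix M assume "M \<in> weighted_msets fst (trans_types r) m"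
  then obtain gs where "gs \<in> perm_tuples r m" "orbit_mset r {1..m} (nth gs) = M"
    using ex_perm_tuple_orbit_mset[of M r m] by (auto simp: weighted_msets_def)
  then show "M \<in> (\<lambda>gs. orbit_mset r {1..m} (nth gs)) ` perm_tuples r m" by blast
qed

section \<open>Burnside's lemma for tuples of permutations\<close>

lemma sum_card_Collect_swap:
  assumes "finite X" "finite Y"
  shows "(\<Sum>x\<in>X. card {y \<in> Y. Q x y}) = (\<Sum>y\<in>Y. card {x \<in> X. Q x y})"
proof -
  have "(\<Sum>x\<in>X. card {y \<in> Y. Q x y}) = (\<Sum>x\<in>X. \<Sum>y\<in>Y. if Q x y then 1 else 0)"
    using assms(2) by (simp add: sum.If_cases Int_def)
  also have "\<dots> = (\<Sum>y\<in>Y. \<Sum>x\<in>X. if Q x y then 1 else 0)" by (rule sum.swap)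
  also have "\<dots> = (\<Sum>y\<in>Y. card {x \<in> X. Q x y})"
    using assms(1) by (simp add: sum.If_cases Int_def)
  finally show ?thesis .
qed

lemma card_isos_perm_tuple:
  assumes "gs \<in> perm_tuples r m" "hs \<in> perm_tuples r m"
  shows "card (isos r {1..m} (nth gs) {1..m} (nth hs)) =
    card {\<sigma> \<in> {\<sigma>. \<sigma> permutes {1..m}}. \<forall>i<r. \<sigma> \<circ> gs ! i = hs ! i \<circ> \<sigma>}"
  using bij_betw_same_card[OF isos_perm_tuple_bij[OF assms]] by simp

text \<open>The orbit-stabilizer theorem in additive form: each of the \<open>fact m\<close>
  permutations \<sigma> is an isomorphism from \<open>gs\<close> to exactly one tuple, the conjugate
  of \<open>gs\<close> by \<sigma>.\<close>

lemma sum_card_isos_perm_tuple: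
  assumes gs: "gs \<in> perm_tuples r m"
  shows "(\<Sum>hs\<in>perm_tuples r m. card (isos r {1..m} (nth gs) {1..m} (nth hs))) = fact m"
proof -
  let ?S = "{\<sigma>. \<sigma> permutes {1..m}}"
  have finS: "finite ?S" by (simp add: finite_permutations)
  have "(\<Sum>hs\<in>perm_tuples r m. card (isos r {1..m} (nth gs) {1..m} (nth hs))) =
      (\<Sum>hs\<in>perm_tuples r m. card {\<sigma> \<in> ?S. \<forall>i<r. \<sigma> \<circ> gs ! i = hs ! i \<circ> \<sigma>})"
    by (rule sum.cong[OF refl card_isos_perm_tuple[OF gs]])
  also have "\<dots> = (\<Sum>\<sigma>\<in>?S. card {hs \<in> perm_tuples r m. \<forall>i<r. \<sigma> \<circ> gs ! i = hs ! i \<circ> \<sigma>})"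
    by (rule sum_card_Collect_swap[OF finite_perm_tuples finS])
  also have "\<dots> = (\<Sum>\<sigma>\<in>?S. 1)"
  proof (rule sum.cong[OF refl])
    fix \<sigma> assume "\<sigma> \<in> ?S"
    then have \<sigma>: "\<sigma> permutes {1..m}" by simp
    note inv = permutes_inv_o[OF \<sigma>]
    define hs where "hs = map (\<lambda>g. \<sigma> \<circ> g \<circ> inv' \<sigma>) gs"
    have "{hs \<in> perm_tuples r m. \<forall>i<r. \<sigma> \<circ> gs ! i = hs ! i \<circ> \<sigma>} = {hs}"
    proof (intro Set.set_eqI iffI)
      fix ks assume ks: "ks \<in> {hs \<in> perm_tuples r m. \<forall>i<r. \<sigma> \<circ> gs ! i = hs ! i \<circ> \<sigma>}"
      have "ks ! i = \<sigma> \<circ> gs ! i \<circ> inv' \<sigma>" if "i < r" for i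
      proof -
        have "ks ! i = (ks ! i \<circ> \<sigma>) \<circ> inv' \<sigma>" by (simp add: comp_assoc inv)
        then show ?thesis using ks that by simp
      qed
      then show "ks \<in> {hs}" using ks gs by (auto simp: hs_def perm_tuples_iff intro!: nth_equalityI)
    next
      fix ks assume "ks \<in> {hs}"
      then show "ks \<in> {hs \<in> perm_tuples r m. \<forall>i<r. \<sigma> \<circ> gs ! i = hs ! i \<circ> \<sigma>}"
        using gs \<sigma> by (auto simp: hs_def perm_tuples_iff comp_assoc inv intro!: permutes_compose permutes_inv)
    qed
    then show "card {hs \<in> perm_tuples r m. \<forall>i<r. \<sigma> \<circ> gs ! i = hs ! i \<circ> \<sigma>} = 1" by simp
  qed
  also have "\<dots> = fact m" by (simp add: card_permutations[OF refl])
  finally show ?thesis .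
qed

lemma singleton_perm_tuple: "[\<sigma>] \<in> perm_tuples (Suc 0) m \<longleftrightarrow> \<sigma> permutes {1..m}"
  by (simp add: perm_tuples_iff)

lemma perm_tuples_1: "perm_tuples (Suc 0) m = (\<lambda>\<sigma>. [\<sigma>]) ` {\<sigma>. \<sigma> permutes {1..m}}"
proof (intro equalityI subsetI)
  fix gs assume "gs \<in> perm_tuples (Suc 0) m"
  then show "gs \<in> (\<lambda>\<sigma>. [\<sigma>]) ` {\<sigma>. \<sigma> permutes {1..m}}"
    by (cases gs) (auto simp: perm_tuples_iff)
qed (auto simp: singleton_perm_tuple)

text \<open>The commuting pairs of a tuple and a permutation are counted twice. Within a class,
  automorphisms of \<open>gs\<close> are as many as isomorphisms from a fixed \<open>ks\<close> to
  \<open>gs\<close>, so the class contributes \<open>fact m\<close>. For fixed \<sigma>, the tuples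
  commuting with \<sigma> are the lists of length \<open>r\<close> over its centralizer.\<close>

lemma burnside_perm_tuples:
  "fact m * card (weighted_msets fst (trans_types r) m) =
    (\<Sum>\<sigma> | \<sigma> permutes {1..m}. card (isos (Suc 0) {1..m} (nth [\<sigma>]) {1..m} (nth [\<sigma>])) ^ r)"
proof -
  let ?P = "perm_tuples r m" and ?S = "{\<sigma>. \<sigma> permutes {1..m}}"
  let ?f = "\<lambda>gs. orbit_mset r {1..m} (nth gs)"
  let ?I = "\<lambda>gs hs. card (isos r {1..m} (nth gs) {1..m} (nth hs))"
  have finS: "finite ?S" by (simp add: finite_permutations)
  have "(\<Sum>gs\<in>?P. ?I gs gs) = (\<Sum>v\<in>?f ` ?P. \<Sum>gs | gs \<in> ?P \<and> ?f gs = v. ?I gs gs)"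
    by (rule sum.image_gen[OF finite_perm_tuples])
  also have "\<dots> = (\<Sum>v\<in>?f ` ?P. fact m)"
  proof (rule sum.cong[OF refl])
    fix v assume "v \<in> ?f ` ?P"
    then obtain ks where ks: "ks \<in> ?P" "v = ?f ks" by (rule imageE)
    have "(\<Sum>gs | gs \<in> ?P \<and> ?f gs = v. ?I gs gs) = (\<Sum>gs | gs \<in> ?P \<and> ?f gs = v. ?I ks gs)"
    proof (rule sum.cong[OF refl])
      fix gs assume "gs \<in> {gs. gs \<in> ?P \<and> ?f gs = v}"
      then have gs: "gs \<in> ?P" "?f ks = ?f gs" using ks by auto
      obtain f where f: "f \<in> isos r {1..m} (nth ks) {1..m} (nth gs)"
        using orbit_mset_eq_imp[OF fin_action_perm_tuple[OF ks(1)] fin_action_perm_tuple[OF gs(1)] gs(2)] by blast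
      show "?I gs gs = ?I ks gs"
        by (rule card_isos_transport[OF fin_action_perm_tuple[OF ks(1)] fin_action_perm_tuple[OF gs(1)] f, symmetric])
    qed
    also have "\<dots> = (\<Sum>gs\<in>?P. ?I ks gs)"
    proof (rule sum.mono_neutral_left[OF finite_perm_tuples])
      show "\<forall>gs\<in>?P - {gs. gs \<in> ?P \<and> ?f gs = v}. ?I ks gs = 0"
      proof
        fix gs assume gs: "gs \<in> ?P - {gs. gs \<in> ?P \<and> ?f gs = v}"
        then have "isos r {1..m} (nth ks) {1..m} (nth gs) = {}"
          using orbit_mset_iso[OF fin_action_perm_tuple[OF ks(1)] fin_action_perm_tuple[of gs]] ks(2) by fastforce
        then show "?I ks gs = 0" by simp
      qed
    qed auto
    also have "\<dots> = fact m" by (rule sum_card_isos_perm_tuple[OF ks(1)])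
    finally show "(\<Sum>gs | gs \<in> ?P \<and> ?f gs = v. ?I gs gs) = fact m" .
  qed
  finally have "fact m * card (?f ` ?P) = (\<Sum>gs\<in>?P. ?I gs gs)" by simp
  also have "\<dots> = (\<Sum>gs\<in>?P. card {\<sigma> \<in> ?S. \<forall>i<r. \<sigma> \<circ> gs ! i = gs ! i \<circ> \<sigma>})"
    by (rule sum.cong[OF refl card_isos_perm_tuple])
  also have "\<dots> = (\<Sum>\<sigma>\<in>?S. card {gs \<in> ?P. \<forall>i<r. \<sigma> \<circ> gs ! i = gs ! i \<circ> \<sigma>})"
    by (rule sum_card_Collect_swap[OF finite_perm_tuples finS])
  also have "\<dots> = (\<Sum>\<sigma>\<in>?S. card (isos (Suc 0) {1..m} (nth [\<sigma>]) {1..m} (nth [\<sigma>])) ^ r)"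
  proof (rule sum.cong[OF refl])
    fix \<sigma> assume \<sigma>: "\<sigma> \<in> ?S"
    define C where "C = {g \<in> ?S. g \<circ> \<sigma> = \<sigma> \<circ> g}"
    have "{gs \<in> ?P. \<forall>i<r. \<sigma> \<circ> gs ! i = gs ! i \<circ> \<sigma>} = {gs. set gs \<subseteq> C \<and> length gs = r}"
      by (auto simp: perm_tuples_iff C_def subset_iff in_set_conv_nth)
    moreover have "finite C" using finS by (simp add: C_def)
    moreover have "card C = card (isos (Suc 0) {1..m} (nth [\<sigma>]) {1..m} (nth [\<sigma>]))"
      using \<sigma> by (subst card_isos_perm_tuple) (auto simp: singleton_perm_tuple C_def)
    ultimately show "card {gs \<in> ?P. \<forall>i<r. \<sigma> \<circ> gs ! i = gs ! i \<circ> \<sigma>} =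
        card (isos (Suc 0) {1..m} (nth [\<sigma>]) {1..m} (nth [\<sigma>])) ^ r"
      by (simp add: card_lists_length_eq)
  qed
  finally show ?thesis by (simp only: image_orbit_mset_perm_tuples)
qed

section \<open>Cycle types and the number of all classes\<close>

lemma orb_count_in_mult_vectors:
  assumes a: "fin_action r A s"
  shows "orb_count r A s \<in> mult_vectors (card A)"
proof -
  have range: "card P \<in> {1..card A}" if "P \<in> orbs r A s" for P
    using card_orb_pos[OF a that] card_orb_le[OF a that] by simp
  have "card A = (\<Sum>P\<in>orbs r A s. card P)" by (rule sum_card_orbs[OF a, symmetric])
  also have "\<dots> = (\<Sum>j\<in>{1..card A}. \<Sum>P | P \<in> orbs r A s \<and> card P = j. card P)"
    by (rule sum.group[OF finite_orbs[OF a], symmetric]) (use range in auto)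
  also have "\<dots> = (\<Sum>j\<in>{1..card A}. j * orb_count r A s j)"
    by (rule sum.cong) (auto simp: orb_count_def)
  finally have "(\<Sum>j\<in>{1..card A}. j * orb_count r A s j) = card A" by simp
  moreover have "j \<in> {1..card A}" if "orb_count r A s j \<noteq> 0" for j
  proof -
    have "{P \<in> orbs r A s. card P = j} \<noteq> {}" using that unfolding orb_count_def by (metis card.empty)
    then show ?thesis using range by blast
  qed
  ultimately show ?thesis by (simp add: mult_vectors_def)
qed

lemma rotation_action:
  fixes j :: nat
  assumes j: "0 < j"
  shows "fin_action (Suc 0) {..<j} (\<lambda>i x. (x + 1) mod j)" "trans_action (Suc 0) {..<j} (\<lambda>i x. (x + 1) mod j)"
proof -
  let ?p = "\<lambda>x. (x + 1) mod j"
  have surj: "{..<j} \<subseteq> ?p ` {..<j}"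
  proof
    fix y assume y: "y \<in> {..<j}"
    show "y \<in> ?p ` {..<j}"
    proof (cases y)
      case 0
      then show ?thesis using j by (intro image_eqI[of _ _ "j - 1"]) auto
    next
      case (Suc x)
      then show ?thesis using y by (intro image_eqI[of _ _ x]) auto
    qed
  qed
  then have "inj_on ?p {..<j}" by (rule finite_surj_inj[rotated]) simp
  moreover have "?p ` {..<j} \<subseteq> {..<j}" using j by auto
  ultimately show a: "fin_action (Suc 0) {..<j} (\<lambda>i. ?p)"
    using surj by (auto simp: fin_action_def bij_betw_def)
  have 0: "(0, x) \<in> reach (Suc 0) {..<j} (\<lambda>i. ?p)" if "x < j" for x
    using that
  proof (induction x)
    case 0 then show ?case by (intro reach_refl) simp
  next
    case (Suc x)
    then have "(x, ?p x) \<in> reach (Suc 0) {..<j} (\<lambda>i. ?p)" by (intro reach_step[OF a]) auto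
    then show ?case using reach_trans[OF Suc.IH, of "?p x"] Suc.prems by simp
  qed
  show "trans_action (Suc 0) {..<j} (\<lambda>i. ?p)"
    using j 0 reach_trans[OF reach_sym[OF a 0] 0] by (auto simp: trans_action_def lessThan_empty_iff)
qed

text \<open>The disjoint union of \<open>\<kappa> j\<close> rotations of length \<open>j\<close>,
  over all \<open>j\<close>, has the required cycles; it is then carried to
  \<open>{1..k}\<close>.\<close>

lemma ex_perm_cycle_type:
  assumes \<kappa>: "\<kappa> \<in> mult_vectors k"
  shows "\<exists>\<sigma>. \<sigma> permutes {1..k} \<and> orb_count (Suc 0) {1..k} (nth [\<sigma>]) = \<kappa>"
proof -
  define P where "P = Sigma {1..k} (\<lambda>j. {..<\<kappa> j})"
  define D :: "nat \<times> nat \<Rightarrow> nat set" where "D = (\<lambda>p. {..<fst p})"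
  define u where "u = (\<lambda>(p :: nat \<times> nat) (i :: nat) x. (x + 1) mod fst p)"
  define A where "A = Sigma P D"
  have D: "fin_action (Suc 0) (D p) (u p)" "trans_action (Suc 0) (D p) (u p)" if "p \<in> P" for p
    using rotation_action[of "fst p"] that by (auto simp: D_def u_def P_def)
  have finP: "finite P" by (simp add: P_def)
  have a: "fin_action (Suc 0) A (sigma_act u)" unfolding A_def by (rule fin_action_Sigma[OF finP D(1)])
  have orbs: "orbs (Suc 0) A (sigma_act u) = (\<lambda>p. {p} \<times> D p) ` P"
    unfolding A_def by (rule orbs_Sigma[OF finP D])
  have ne: "D p \<noteq> {}" if "p \<in> P" for p using that by (auto simp: P_def D_def lessThan_empty_iff)
  have inj: "inj_on (\<lambda>p. {p} \<times> D p) P" using ne by (auto simp: inj_on_def times_eq_iff)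
  have cnt: "orb_count (Suc 0) A (sigma_act u) = \<kappa>"
  proof
    fix j
    have "{Q \<in> orbs (Suc 0) A (sigma_act u). card Q = j} = (\<lambda>p. {p} \<times> D p) ` {p \<in> P. fst p = j}"
      by (auto simp: orbs D_def card_cartesian_product)
    then have "orb_count (Suc 0) A (sigma_act u) j = card {p \<in> P. fst p = j}"
      by (simp add: orb_count_def card_image inj_on_subset[OF inj])
    also have "{p \<in> P. fst p = j} = {j} \<times> {..<\<kappa> j}"
      using \<kappa> by (auto simp: P_def mult_vectors_def)
    finally show "orb_count (Suc 0) A (sigma_act u) j = \<kappa> j" by (simp add: card_cartesian_product)
  qed
  have "card A = (\<Sum>p\<in>P. card (D p))" unfolding A_def by (rule card_SigmaI) (auto simp: finP D_def)
  also have "\<dots> = (\<Sum>(j, i)\<in>P. j)" by (simp add: D_def split_def)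
  also have "\<dots> = (\<Sum>j\<in>{1..k}. \<Sum>i<\<kappa> j. j)" unfolding P_def by (rule sum.Sigma[symmetric]) auto
  also have "\<dots> = k" using \<kappa> by (simp add: mult_vectors_def mult.commute)
  finally have "card A = k" .
  then obtain gs f where gs: "gs \<in> perm_tuples (Suc 0) k" and f: "f \<in> isos (Suc 0) A (sigma_act u) {1..k} (nth gs)"
    using ex_isomorphic_perm_tuple[OF a] by blast
  obtain \<sigma> where "\<sigma> permutes {1..k}" "gs = [\<sigma>]" using gs unfolding perm_tuples_1 by blast
  then show ?thesis using orb_count_iso[OF a f] cnt by metis
qed

lemma finite_mult_vectors: "finite (mult_vectors m)"
proof -
  have "mult_vectors m \<subseteq> {n. \<forall>k. (k \<in> {1..m} \<longrightarrow> n k \<in> {0..m}) \<and> (k \<notin> {1..m} \<longrightarrow> n k = 0)}"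
  proof
    fix n assume n: "n \<in> mult_vectors m"
    have "n k \<le> m" if k: "k \<in> {1..m}" for k
    proof -
      have "1 * n k \<le> k * n k" using k by (intro mult_le_mono1) simp
      also have "\<dots> \<le> (\<Sum>k=1..m. k * n k)" by (rule member_le_sum[OF k]) auto
      also have "\<dots> = m" using n by (simp add: mult_vectors_def)
      finally show ?thesis by simp
    qed
    then show "n \<in> {n. \<forall>k. (k \<in> {1..m} \<longrightarrow> n k \<in> {0..m}) \<and> (k \<notin> {1..m} \<longrightarrow> n k = 0)}"
      using n by (auto simp: mult_vectors_def)
  qed
  moreover have "finite {n. \<forall>k. (k \<in> {1..m} \<longrightarrow> n k \<in> {0..m}) \<and> (k \<notin> {1..m} \<longrightarrow> n k = (0::nat))}"
    by (rule finite_set_of_finite_funs) auto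
  ultimately show ?thesis by (rule finite_subset)
qed

text \<open>Isomorphisms from a fixed \<sigma> of cycle type \<kappa> exist only to permutations of
  the same type, \<open>z_part k \<kappa>\<close> to each; as all of them together number
  \<open>fact k\<close>, class size times \<open>z_part\<close> is \<open>fact k\<close>. This
  absorbs one of the \<open>r\<close> factors in Burnside's sum and explains the exponent
  \<open>r - 1\<close>.\<close>

lemma card_weighted_msets_trans_types:
  assumes r: "r \<ge> 1"
  shows "card (weighted_msets fst (trans_types r) k) = (\<Sum>\<kappa>\<in>mult_vectors k. z_part k \<kappa> ^ (r - 1))"
proof -
  let ?S = "{\<sigma>. \<sigma> permutes {1..k}}"
  let ?c = "\<lambda>\<sigma>. orb_count (Suc 0) {1..k} (nth [\<sigma>])"
  let ?I = "\<lambda>\<sigma> \<tau>. card (isos (Suc 0) {1..k} (nth [\<sigma>]) {1..k} (nth [\<tau>]))"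
  have finS: "finite ?S" by (simp add: finite_permutations)
  have a: "fin_action (Suc 0) {1..k} (nth [\<sigma>])" if "\<sigma> \<in> ?S" for \<sigma>
    using that by (intro fin_action_perm_tuple) (simp add: singleton_perm_tuple)
  have I: "?I \<sigma> \<tau> = (if ?c \<sigma> = ?c \<tau> then z_part k (?c \<sigma>) else 0)" if "\<sigma> \<in> ?S" "\<tau> \<in> ?S" for \<sigma> \<tau>
  proof (cases "?c \<sigma> = ?c \<tau>")
    case True
    then show ?thesis using card_isos_eq_z_part[OF a[OF that(1)] a[OF that(2)], of "?c \<sigma>" k] by simp
  next
    case False
    then have "isos (Suc 0) {1..k} (nth [\<sigma>]) {1..k} (nth [\<tau>]) = {}"
      using orb_count_iso[OF a[OF that(1)], of _ "{1..k}" "nth [\<tau>]"] by blast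
    then show ?thesis using False by simp
  qed
  have class_size: "card {\<sigma> \<in> ?S. ?c \<sigma> = \<kappa>} * z_part k \<kappa> = fact k" if "\<kappa> \<in> mult_vectors k" for \<kappa>
  proof -
    obtain \<sigma> where \<sigma>: "\<sigma> \<in> ?S" "?c \<sigma> = \<kappa>" using ex_perm_cycle_type[OF \<open>\<kappa> \<in> mult_vectors k\<close>] by blast
    have "fact k = (\<Sum>hs\<in>perm_tuples (Suc 0) k. card (isos (Suc 0) {1..k} (nth [\<sigma>]) {1..k} (nth hs)))"
      using \<sigma> by (intro sum_card_isos_perm_tuple[symmetric]) (simp add: singleton_perm_tuple)
    also have "\<dots> = (\<Sum>\<tau>\<in>?S. ?I \<sigma> \<tau>)" unfolding perm_tuples_1 by (subst sum.reindex) (auto simp: inj_on_def)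
    also have "\<dots> = (\<Sum>\<tau>\<in>?S. if ?c \<tau> = \<kappa> then z_part k \<kappa> else 0)"
      by (rule sum.cong[OF refl]) (use I[OF \<sigma>(1)] \<sigma>(2) in auto)
    also have "\<dots> = card {\<tau> \<in> ?S. ?c \<tau> = \<kappa>} * z_part k \<kappa>"
      by (simp only: sum.inter_filter[OF finS, symmetric]) simp
    finally show ?thesis by simp
  qed
  have "fact k * card (weighted_msets fst (trans_types r) k) = (\<Sum>\<sigma>\<in>?S. ?I \<sigma> \<sigma> ^ r)"
    by (rule burnside_perm_tuples)
  also have "\<dots> = (\<Sum>\<sigma>\<in>?S. z_part k (?c \<sigma>) ^ r)" using I by (intro sum.cong) auto
  also have "\<dots> = (\<Sum>\<kappa>\<in>mult_vectors k. \<Sum>\<sigma> | \<sigma> \<in> ?S \<and> ?c \<sigma> = \<kappa>. z_part k (?c \<sigma>) ^ r)"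
  proof (rule sum.group[OF finS finite_mult_vectors, symmetric], rule image_subsetI)
    fix \<sigma> assume "\<sigma> \<in> ?S"
    from orb_count_in_mult_vectors[OF a[OF this]] show "?c \<sigma> \<in> mult_vectors k" by simp
  qed
  also have "\<dots> = (\<Sum>\<kappa>\<in>mult_vectors k. fact k * z_part k \<kappa> ^ (r - 1))"
  proof (rule sum.cong[OF refl])
    fix \<kappa> assume \<kappa>: "\<kappa> \<in> mult_vectors k"
    have "(\<Sum>\<sigma> | \<sigma> \<in> ?S \<and> ?c \<sigma> = \<kappa>. z_part k (?c \<sigma>) ^ r) = (\<Sum>\<sigma> | \<sigma> \<in> ?S \<and> ?c \<sigma> = \<kappa>. z_part k \<kappa> ^ r)"
      by (rule sum.cong) auto
    also have "\<dots> = card {\<sigma> \<in> ?S. ?c \<sigma> = \<kappa>} * z_part k \<kappa> * z_part k \<kappa> ^ (r - 1)"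
      using r by (simp add: power_eq_if)
    finally show "(\<Sum>\<sigma> | \<sigma> \<in> ?S \<and> ?c \<sigma> = \<kappa>. z_part k (?c \<sigma>) ^ r) = fact k * z_part k \<kappa> ^ (r - 1)"
      by (simp only: class_size[OF \<kappa>])
  qed
  finally show ?thesis by (simp add: sum_distrib_left[symmetric])
qed

section \<open>Multisets of given weight\<close>

lemma sum_mset_eq_sum_count:
  fixes w :: "'a \<Rightarrow> nat"
  assumes "finite F" "set_mset M \<subseteq> F"
  shows "(\<Sum>x\<in>#M. w x) = (\<Sum>x\<in>F. w x * count M x)"
  using assms(2)
proof (induction M)
  case (add y M)
  have "(\<Sum>x\<in>F. w x * count (add_mset y M) x) = (\<Sum>x\<in>F. w x * count M x + (if x = y then w x else 0))"
    by (rule sum.cong) auto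
  then show ?case using add assms(1) by (simp add: sum.distrib)
qed simp

text \<open>The substitution \<open>j = i * v\<close>. In its application \<open>g j\<close>
  contains \<open>m - j\<close>, and the guard keeps truncated subtraction from counting products
  that overshoot \<open>m\<close>.\<close>

lemma sum_multiples_reindex:
  fixes g :: "nat \<Rightarrow> nat"
  assumes "1 \<le> v"
  shows "(\<Sum>i=1..m. if i * v \<le> m then g (i * v) else 0) = (\<Sum>j=1..m. if v dvd j then g j else 0)"
proof -
  have "(\<Sum>i=1..m. if i * v \<le> m then g (i * v) else 0) = (\<Sum>i | i \<in> {1..m} \<and> i * v \<le> m. g (i * v))"
    by (rule sum.inter_filter[symmetric]) simp
  also have "\<dots> = (\<Sum>j | j \<in> {1..m} \<and> v dvd j. g j)"
  proof (rule sum.reindex_bij_witness[of _ "\<lambda>j. j div v" "\<lambda>i. i * v"])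
    fix j assume "j \<in> {j. j \<in> {1..m} \<and> v dvd j}"
    then obtain i where i: "j = v * i" "1 \<le> j" "j \<le> m" by auto
    moreover have "i \<le> m" using mult_le_mono1[OF assms, of i] i by linarith
    ultimately show "j div v \<in> {i. i \<in> {1..m} \<and> i * v \<le> m}" using assms by (auto simp: mult.commute)
  qed (use assms in auto)
  also have "\<dots> = (\<Sum>j=1..m. if v dvd j then g j else 0)"
    by (rule sum.inter_filter) simp
  finally show ?thesis .
qed

text \<open>The counting of multisets uses only these two facts about types and sizes. They keep the
  sets of multisets finite, so that \<open>card\<close> is a genuine count.\<close>

locale weighted_types =
  fixes w :: "'a \<Rightarrow> nat" and T :: "'a set"
  assumes weight_pos: "x \<in> T \<Longrightarrow> 1 \<le> w x"
    and finite_weight: "finite {x \<in> T. w x = j}"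
begin

lemma finite_weight_le: "finite {x \<in> T. w x \<le> m}"
proof -
  have "{x \<in> T. w x \<le> m} = (\<Union>j\<le>m. {x \<in> T. w x = j})" by auto
  then show ?thesis using finite_weight by simp
qed

lemma weight_mem_le: "M \<in> weighted_msets w T m \<Longrightarrow> x \<in># M \<Longrightarrow> x \<in> T \<and> w x \<le> m"
  by (auto simp: weighted_msets_def dest!: multi_member_split)

lemma finite_weighted_msets: "finite (weighted_msets w T m)"
proof (induction m rule: less_induct)
  case (less m)
  let ?F = "{x \<in> T. w x \<le> m}"
  have "weighted_msets w T m \<subseteq> {{#}} \<union> (\<Union>x\<in>?F. add_mset x ` weighted_msets w T (m - w x))"
  proof
    fix M assume M: "M \<in> weighted_msets w T m"
    show "M \<in> {{#}} \<union> (\<Union>x\<in>?F. add_mset x ` weighted_msets w T (m - w x))"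
    proof (cases M)
      case (add x N)
      have x: "x \<in> ?F" using weight_mem_le[OF M, of x] add by simp
      have "N \<in> weighted_msets w T (m - w x)" using M add by (auto simp: weighted_msets_def)
      then show ?thesis using x add by blast
    qed simp
  qed
  moreover have "finite (weighted_msets w T (m - w x))" if "x \<in> ?F" for x
    using less weight_pos[of x] that by simp
  ultimately show ?case using finite_weight_le[of m] by (auto intro: finite_subset)
qed

lemma card_weighted_msets_0: "card (weighted_msets w T 0) = 1"
proof -
  have "weighted_msets w T 0 = {{#}}"
  proof (intro Set.set_eqI iffI)
    fix M assume M: "M \<in> weighted_msets w T 0"
    then have "M = {#}" using weight_mem_le[OF M] weight_pos by (cases M) fastforce+
    then show "M \<in> {{#}}" by simp
  qed (simp add: weighted_msets_def)
  then show ?thesis by simp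
qed

lemma card_weighted_msets_count_ge:
  assumes x: "x \<in> T" and "i * w x \<le> m"
  shows "card {M \<in> weighted_msets w T m. i \<le> count M x} = card (weighted_msets w T (m - i * w x))"
proof (rule bij_betw_same_card[OF bij_betw_byWitness[where f' = "\<lambda>N. N + replicate_mset i x"], of _ "\<lambda>M. M - replicate_mset i x"])
  have sub: "i \<le> count M x \<longleftrightarrow> replicate_mset i x \<subseteq># M" for M
    by (simp add: count_le_replicate_mset_subset_eq)
  show "\<forall>M\<in>{M \<in> weighted_msets w T m. i \<le> count M x}. M - replicate_mset i x + replicate_mset i x = M"
    by (simp add: sub)
  show "\<forall>N\<in>weighted_msets w T (m - i * w x). N + replicate_mset i x - replicate_mset i x = N" by simp
  show "(\<lambda>M. M - replicate_mset i x) ` {M \<in> weighted_msets w T m. i \<le> count M x} \<subseteq> weighted_msets w T (m - i * w x)"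
  proof (rule image_subsetI)
    fix M assume M: "M \<in> {M \<in> weighted_msets w T m. i \<le> count M x}"
    define N where "N = M - replicate_mset i x"
    have "M = N + replicate_mset i x" using M by (simp add: sub N_def)
    then show "N \<in> weighted_msets w T (m - i * w x)" using M by (auto simp: weighted_msets_def)
  qed
  show "(\<lambda>N. N + replicate_mset i x) ` weighted_msets w T (m - i * w x) \<subseteq> {M \<in> weighted_msets w T m. i \<le> count M x}"
    using assms by (auto simp: weighted_msets_def split: if_splits)
qed

text \<open>Double counting of \<open>\<Sum>M. \<Sum>x\<in>#M. w x\<close>: the multisets containing \<open>x\<close> at least \<open>i\<close> times
  correspond to arbitrary multisets of weight \<open>m - i * w x\<close>.\<close>
lemma card_weighted_msets_recurrence:
  "m * card (weighted_msets w T m) =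
    (\<Sum>j=1..m. (\<Sum>e | e dvd j. e * card {x \<in> T. w x = e}) * card (weighted_msets w T (m - j)))"
proof -
  let ?W = "weighted_msets w T"
  let ?F = "{x \<in> T. w x \<le> m}"
  have weight: "m = (\<Sum>x\<in>?F. w x * count M x)" if M: "M \<in> ?W m" for M
  proof -
    have "m = (\<Sum>x\<in>#M. w x)" using M by (simp add: weighted_msets_def)
    also have "\<dots> = (\<Sum>x\<in>?F. w x * count M x)"
      by (rule sum_mset_eq_sum_count[OF finite_weight_le]) (use weight_mem_le[OF M] in auto)
    finally show ?thesis .
  qed
  have cnt: "count M x = (\<Sum>i=1..m. if i \<le> count M x then 1 else 0)" if M: "M \<in> ?W m" and x: "x \<in> ?F" for M x
  proof -
    have "count M x \<le> w x * count M x" using weight_pos[of x] x by simp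
    also have "\<dots> \<le> (\<Sum>x\<in>?F. w x * count M x)"
      by (rule member_le_sum[OF x _ finite_weight_le]) simp
    also have "\<dots> = m" using weight[OF M] by simp
    finally have "{i \<in> {1..m}. i \<le> count M x} = {1..count M x}" by auto
    then show ?thesis by (simp add: sum.inter_filter[symmetric])
  qed
  have "m * card (?W m) = (\<Sum>M\<in>?W m. \<Sum>x\<in>?F. w x * count M x)"
    using weight by simp
  also have "\<dots> = (\<Sum>x\<in>?F. \<Sum>M\<in>?W m. w x * count M x)" by (rule sum.swap)
  also have "\<dots> = (\<Sum>x\<in>?F. \<Sum>j=1..m. if w x dvd j then w x * card (?W (m - j)) else 0)"
  proof (rule sum.cong[OF refl])
    fix x assume x: "x \<in> ?F"
    have "(\<Sum>M\<in>?W m. count M x) = (\<Sum>M\<in>?W m. \<Sum>i=1..m. if i \<le> count M x then 1 else 0)"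
      by (rule sum.cong[OF refl cnt[OF _ x]])
    also have "\<dots> = (\<Sum>i=1..m. \<Sum>M\<in>?W m. if i \<le> count M x then 1 else 0)" by (rule sum.swap)
    also have "\<dots> = (\<Sum>i=1..m. card {M \<in> ?W m. i \<le> count M x})"
      by (simp add: sum.inter_filter[OF finite_weighted_msets, symmetric])
    also have "\<dots> = (\<Sum>i=1..m. if i * w x \<le> m then card (?W (m - i * w x)) else 0)"
    proof (rule sum.cong[OF refl])
      fix i
      show "card {M \<in> ?W m. i \<le> count M x} = (if i * w x \<le> m then card (?W (m - i * w x)) else 0)"
      proof (cases "i * w x \<le> m")
        case True
        then show ?thesis using card_weighted_msets_count_ge x by simp
      next
        case False
        have "\<not> i \<le> count M x" if M: "M \<in> ?W m" for M
        proof
          assume "i \<le> count M x"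
          then have "i * w x \<le> w x * count M x" by simp
          also have "\<dots> \<le> (\<Sum>x\<in>?F. w x * count M x)"
            by (rule member_le_sum[OF x _ finite_weight_le]) simp
          finally show False using False weight[OF M] by simp
        qed
        then have empty: "{M \<in> ?W m. i \<le> count M x} = {}" by blast
        show ?thesis using False by (subst empty) simp
      qed
    qed
    also have "\<dots> = (\<Sum>j=1..m. if w x dvd j then card (?W (m - j)) else 0)"
      using weight_pos x by (intro sum_multiples_reindex) simp
    finally show "(\<Sum>M\<in>?W m. w x * count M x) = (\<Sum>j=1..m. if w x dvd j then w x * card (?W (m - j)) else 0)"
      by (simp add: sum_distrib_left[symmetric]) (simp add: sum_distrib_left if_distrib cong: if_cong)
  qed
  also have "\<dots> = (\<Sum>j=1..m. \<Sum>x\<in>?F. if w x dvd j then w x * card (?W (m - j)) else 0)" by (rule sum.swap)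
  also have "\<dots> = (\<Sum>j=1..m. (\<Sum>e | e dvd j. e * card {x \<in> T. w x = e}) * card (?W (m - j)))"
  proof (rule sum.cong[OF refl])
    fix j assume j: "j \<in> {1..m}"
    let ?G = "{x \<in> ?F. w x dvd j}"
    have finG: "finite ?G" by (rule finite_subset[OF _ finite_weight_le[of m]]) auto
    have "(\<Sum>x\<in>?G. w x) = (\<Sum>e | e dvd j. \<Sum>x | x \<in> ?G \<and> w x = e. w x)"
      using j by (intro sum.group[symmetric] finG) auto
    also have "\<dots> = (\<Sum>e | e dvd j. e * card {x \<in> T. w x = e})"
    proof (rule sum.cong[OF refl])
      fix e assume "e \<in> {e. e dvd j}"
      then have "e dvd j" "e \<le> m" using j by (auto dest: dvd_imp_le)
      then have "{x. x \<in> ?G \<and> w x = e} = {x \<in> T. w x = e}" by auto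
      then show "(\<Sum>x | x \<in> ?G \<and> w x = e. w x) = e * card {x \<in> T. w x = e}" by simp
    qed
    finally have eq: "(\<Sum>x\<in>?G. w x) = (\<Sum>e | e dvd j. e * card {x \<in> T. w x = e})" .
    have "(\<Sum>x\<in>?F. if w x dvd j then w x * card (?W (m - j)) else 0) = (\<Sum>x\<in>?G. w x * card (?W (m - j)))"
      by (rule sum.inter_filter[OF finite_weight_le, symmetric])
    then show "(\<Sum>x\<in>?F. if w x dvd j then w x * card (?W (m - j)) else 0) =
      (\<Sum>e | e dvd j. e * card {x \<in> T. w x = e}) * card (?W (m - j))"
      by (simp only: eq sum_distrib_right[symmetric])
  qed
  finally show ?thesis .
qed

end

text \<open>A type of size \<open>j\<close> is \<open>j\<close> together with a set of tuples on
  \<open>j\<close> points, which leaves finitely many choices.\<close>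

lemma weighted_types_trans_types: "weighted_types fst (trans_types r)"
proof
  fix \<tau> assume "\<tau> \<in> trans_types r"
  then show "1 \<le> fst \<tau>"
    by (auto simp: trans_types_def orb_type_def trans_action_def fin_action_def Suc_le_eq card_gt_0_iff)
next
  fix j
  have "{\<tau> \<in> trans_types r. fst \<tau> = j} \<subseteq> {j} \<times> Pow (perm_tuples r j)"
    by (auto simp: trans_types_def orb_type_def)
  then show "finite {\<tau> \<in> trans_types r. fst \<tau> = j}"
    by (rule finite_subset) (simp add: finite_perm_tuples)
qed

section \<open>The logarithm of a power series\<close>

context
  fixes a :: "nat \<Rightarrow> real"
begin

text \<open>Let B be the sum of the \<open>a k\<close> X^k over k \<ge> 1. By the multinomial
  theorem this is the coefficient of X^m in the sum over l of \<open>g l / fact l\<close> times B^l.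
  Keeping \<open>g\<close> free covers 1/(1 + B) and log (1 + B) at once.\<close>

definition multisum :: "(nat \<Rightarrow> real) \<Rightarrow> nat \<Rightarrow> real" where
  "multisum g m = (\<Sum>n\<in>mult_vectors m. g (\<Sum>k=1..m. n k) * (\<Prod>k=1..m. a k ^ n k / fact (n k)))"

lemma mult_vectors_extend:
  assumes n: "n \<in> mult_vectors m" and "m \<le> N"
  shows "(\<Sum>k=1..N. n k) = (\<Sum>k=1..m. n k)"
    and "(\<Prod>k=1..N. a k ^ n k / fact (n k)) = (\<Prod>k=1..m. a k ^ n k / fact (n k))"
proof -
  have 0: "n k = 0" if "k \<notin> {1..m}" for k using n that by (auto simp: mult_vectors_def)
  show "(\<Sum>k=1..N. n k) = (\<Sum>k=1..m. n k)"
    by (rule sum.mono_neutral_right) (use 0 \<open>m \<le> N\<close> in auto)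
  show "(\<Prod>k=1..N. a k ^ n k / fact (n k)) = (\<Prod>k=1..m. a k ^ n k / fact (n k))"
    by (rule prod.mono_neutral_right) (use 0 \<open>m \<le> N\<close> in auto)
qed

lemma mult_vectors_remove:
  assumes k: "k \<in> {1..m}"
  shows "bij_betw (\<lambda>n. n(k := n k - 1)) {n \<in> mult_vectors m. n k \<noteq> 0} (mult_vectors (m - k))"
proof (rule bij_betw_byWitness[where f' = "\<lambda>n. n(k := Suc (n k))"])
  have split: "(\<Sum>j=1..m. j * n j) = k * n k + (\<Sum>j\<in>{1..m} - {k}. j * n j)" for n :: "nat \<Rightarrow> nat"
    by (rule sum.remove) (use k in auto)
  have upd: "(\<Sum>j\<in>{1..m} - {k}. j * (n(k := v)) j) = (\<Sum>j\<in>{1..m} - {k}. j * n j)" for n v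
    by (rule sum.cong) auto
  show "(\<lambda>n. n(k := n k - 1)) ` {n \<in> mult_vectors m. n k \<noteq> 0} \<subseteq> mult_vectors (m - k)"
  proof (rule image_subsetI)
    fix n assume n: "n \<in> {n \<in> mult_vectors m. n k \<noteq> 0}"
    define n' where "n' = n(k := n k - 1)"
    obtain q where q: "n k = Suc q" using n by (cases "n k") auto
    have "(\<Sum>j=1..m. j * n j) = m" using n by (simp add: mult_vectors_def)
    then have s: "(\<Sum>j=1..m. j * n' j) = m - k"
      using split[of n] split[of n'] upd[of n] q by (simp add: n'_def)
    have supp: "j \<in> {1..m - k}" if "n' j \<noteq> 0" for j
    proof -
      have j: "j \<in> {1..m}" using that n k by (auto simp: n'_def mult_vectors_def split: if_splits)
      have "j \<le> j * n' j" using that by simp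
      also have "\<dots> \<le> (\<Sum>j=1..m. j * n' j)" by (rule member_le_sum[OF j]) auto
      finally show ?thesis using s j by simp
    qed
    have "(\<Sum>j=1..m. j * n' j) = (\<Sum>j=1..m - k. j * n' j)"
      by (rule sum.mono_neutral_right) (use supp in fastforce)+
    then show "n' \<in> mult_vectors (m - k)" using s supp by (simp add: mult_vectors_def)
  qed
  show "(\<lambda>n. n(k := Suc (n k))) ` mult_vectors (m - k) \<subseteq> {n \<in> mult_vectors m. n k \<noteq> 0}"
  proof (rule image_subsetI)
    fix n assume n: "n \<in> mult_vectors (m - k)"
    define n' where "n' = n(k := Suc (n k))"
    have "(\<Sum>j=1..m. j * n j) = (\<Sum>j=1..m - k. j * n j)"
      by (rule sum.mono_neutral_right) (use n in \<open>auto simp: mult_vectors_def\<close>)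
    then have "k * n k + (\<Sum>j\<in>{1..m} - {k}. j * n j) = m - k"
      using n split[of n] by (simp add: mult_vectors_def)
    moreover have "(\<Sum>j=1..m. j * n' j) = k + (k * n k + (\<Sum>j\<in>{1..m} - {k}. j * n j))"
    proof -
      have "n' k = Suc (n k)" "(\<Sum>j\<in>{1..m} - {k}. j * n' j) = (\<Sum>j\<in>{1..m} - {k}. j * n j)"
        unfolding n'_def upd by simp_all
      then show ?thesis unfolding split[of n'] by simp
    qed
    ultimately have "(\<Sum>j=1..m. j * n' j) = m" using k by simp
    moreover have "j \<in> {1..m}" if "n' j \<noteq> 0" for j
    proof (cases "j = k")
      case False
      then have "j \<in> {1..m - k}" using that n by (simp add: n'_def mult_vectors_def)
      then show ?thesis by auto
    qed (use k in simp)
    ultimately show "n' \<in> {n \<in> mult_vectors m. n k \<noteq> 0}" by (simp add: mult_vectors_def n'_def)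
  qed
qed auto

text \<open>The effect of \<open>a k\<close> times the partial derivative in \<open>a k\<close>: the
  factor \<open>n k\<close> cancels against the factorial, one part of size \<open>k\<close>
  disappears, and the number of parts drops by one, which shifts \<open>g\<close>.\<close>

lemma multisum_remove:
  assumes k: "k \<in> {1..m}"
  shows "(\<Sum>n\<in>mult_vectors m. real (n k) * (g (\<Sum>k=1..m. n k) * (\<Prod>k=1..m. a k ^ n k / fact (n k))))
    = a k * multisum (\<lambda>q. g (Suc q)) (m - k)"
proof -
  let ?Q = "\<lambda>n. \<Prod>k=1..m. a k ^ n k / fact (n k)"
  have "(\<Sum>n\<in>mult_vectors m. real (n k) * (g (\<Sum>k=1..m. n k) * ?Q n)) =
      (\<Sum>n | n \<in> mult_vectors m \<and> n k \<noteq> 0. real (n k) * (g (\<Sum>k=1..m. n k) * ?Q n))"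
    by (rule sum.mono_neutral_right[OF finite_mult_vectors]) auto
  also have "\<dots> = (\<Sum>n | n \<in> mult_vectors m \<and> n k \<noteq> 0.
      a k * (g (Suc (\<Sum>j=1..m. (n(k := n k - 1)) j)) * ?Q (n(k := n k - 1))))"
  proof (rule sum.cong[OF refl])
    fix n assume "n \<in> {n. n \<in> mult_vectors m \<and> n k \<noteq> 0}"
    then obtain q where q: "n k = Suc q" by (cases "n k") auto
    have r1: "(\<Sum>j=1..m. n' j) = n' k + (\<Sum>j\<in>{1..m} - {k}. n' j)" for n' :: "nat \<Rightarrow> nat"
      by (rule sum.remove) (use k in auto)
    have r2: "?Q n' = a k ^ n' k / fact (n' k) * (\<Prod>j\<in>{1..m} - {k}. a j ^ n' j / fact (n' j))" for n'
      by (rule prod.remove) (use k in auto)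
    have c1: "(\<Sum>j\<in>{1..m} - {k}. (n(k := q)) j) = (\<Sum>j\<in>{1..m} - {k}. n j)"
      by (rule sum.cong) auto
    have c2: "(\<Prod>j\<in>{1..m} - {k}. a j ^ (n(k := q)) j / fact ((n(k := q)) j)) = (\<Prod>j\<in>{1..m} - {k}. a j ^ n j / fact (n j))"
      by (rule prod.cong) auto
    show "real (n k) * (g (\<Sum>k=1..m. n k) * ?Q n) =
        a k * (g (Suc (\<Sum>j=1..m. (n(k := n k - 1)) j)) * ?Q (n(k := n k - 1)))"
      unfolding r1 r2 using c1 c2 q by (simp del: of_nat_Suc fact_Suc) (simp add: fact_Suc)
  qed
  also have "\<dots> = (\<Sum>n\<in>mult_vectors (m - k). a k * (g (Suc (\<Sum>j=1..m. n j)) * ?Q n))"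
    by (rule sum.reindex_bij_betw[OF mult_vectors_remove[OF k],
      of "\<lambda>n. a k * (g (Suc (\<Sum>j=1..m. n j)) * ?Q n)"])
  also have "\<dots> = a k * multisum (\<lambda>q. g (Suc q)) (m - k)"
    unfolding multisum_def sum_distrib_left
    by (rule sum.cong[OF refl]) (simp only: mult_vectors_extend[OF _ diff_le_self])
  finally show ?thesis .
qed

text \<open>Coefficientwise B/(1 + B) = 1 - 1/(1 + B). The left side is expanded with the weights of
  the logarithm, whose shift by one is the sequence of the inverse; summing \<open>n k\<close> over
  \<open>k\<close> gives the number l of parts, and l * (l - 1)! = l!.\<close>

lemma multisum_inverse:
  assumes m: "1 \<le> m"
  shows "(\<Sum>k=1..m. a k * multisum (\<lambda>q. (-1) ^ q * fact q) (m - k)) = - multisum (\<lambda>q. (-1) ^ q * fact q) m"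
proof -
  let ?g = "\<lambda>q. (-1) ^ (q - 1) * fact (q - 1) :: real"
  let ?Q = "\<lambda>n. \<Prod>k=1..m. a k ^ n k / fact (n k)"
  have "(\<Sum>k=1..m. a k * multisum (\<lambda>q. (-1) ^ q * fact q) (m - k)) =
      (\<Sum>k=1..m. \<Sum>n\<in>mult_vectors m. real (n k) * (?g (\<Sum>k=1..m. n k) * ?Q n))"
    by (rule sum.cong[OF refl]) (subst multisum_remove, simp_all)
  also have "\<dots> = (\<Sum>n\<in>mult_vectors m. \<Sum>k=1..m. real (n k) * (?g (\<Sum>k=1..m. n k) * ?Q n))"
    by (rule sum.swap)
  also have "\<dots> = (\<Sum>n\<in>mult_vectors m. - ((-1) ^ (\<Sum>k=1..m. n k) * fact (\<Sum>k=1..m. n k) * ?Q n))"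
  proof (rule sum.cong[OF refl])
    fix n assume n: "n \<in> mult_vectors m"
    have "(\<Sum>k=1..m. n k) \<noteq> 0"
    proof
      assume "(\<Sum>k=1..m. n k) = 0"
      then have "(\<Sum>k=1..m. k * n k) = 0" by simp
      then show False using n m by (simp add: mult_vectors_def)
    qed
    then obtain q where q: "(\<Sum>k=1..m. n k) = Suc q" by (cases "\<Sum>k=1..m. n k") auto
    have "(\<Sum>k=1..m. real (n k) * (?g (\<Sum>k=1..m. n k) * ?Q n)) = real (\<Sum>k=1..m. n k) * (?g (\<Sum>k=1..m. n k) * ?Q n)"
      by (simp only: of_nat_sum sum_distrib_right)
    then show "(\<Sum>k=1..m. real (n k) * (?g (\<Sum>k=1..m. n k) * ?Q n)) = - ((-1) ^ (\<Sum>k=1..m. n k) * fact (\<Sum>k=1..m. n k) * ?Q n)"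
      unfolding q by simp
  qed
  finally show ?thesis by (simp add: multisum_def sum_negf)
qed

text \<open>Removing a part as before, but weighted by its size: the sum of \<open>k * n k\<close>
  is \<open>m\<close>, as in X d/dX applied to the logarithm.\<close>

lemma multisum_log:
  "real m * multisum (\<lambda>q. (-1) ^ (q - 1) * fact (q - 1)) m =
    (\<Sum>k=1..m. real k * a k * multisum (\<lambda>q. (-1) ^ q * fact q) (m - k))"
proof -
  let ?g = "\<lambda>q. (-1) ^ (q - 1) * fact (q - 1) :: real"
  let ?Q = "\<lambda>n. \<Prod>k=1..m. a k ^ n k / fact (n k)"
  have "(\<Sum>k=1..m. real k * a k * multisum (\<lambda>q. (-1) ^ q * fact q) (m - k)) =
      (\<Sum>k=1..m. \<Sum>n\<in>mult_vectors m. real (k * n k) * (?g (\<Sum>k=1..m. n k) * ?Q n))"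
  proof (rule sum.cong[OF refl])
    fix k assume k: "k \<in> {1..m}"
    show "real k * a k * multisum (\<lambda>q. (-1) ^ q * fact q) (m - k) =
      (\<Sum>n\<in>mult_vectors m. real (k * n k) * (?g (\<Sum>k=1..m. n k) * ?Q n))"
      using multisum_remove[OF k, of ?g] by (simp add: sum_distrib_left[symmetric] mult.assoc)
  qed
  also have "\<dots> = (\<Sum>n\<in>mult_vectors m. \<Sum>k=1..m. real (k * n k) * (?g (\<Sum>k=1..m. n k) * ?Q n))"
    by (rule sum.swap)
  also have "\<dots> = (\<Sum>n\<in>mult_vectors m. real m * (?g (\<Sum>k=1..m. n k) * ?Q n))"
  proof (rule sum.cong[OF refl])
    fix n assume "n \<in> mult_vectors m"
    then have "real (\<Sum>k=1..m. k * n k) = real m" by (simp add: mult_vectors_def)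
    then show "(\<Sum>k=1..m. real (k * n k) * (?g (\<Sum>k=1..m. n k) * ?Q n)) = real m * (?g (\<Sum>k=1..m. n k) * ?Q n)"
      by (simp only: of_nat_sum sum_distrib_right[symmetric])
  qed
  finally show ?thesis by (simp only: multisum_def sum_distrib_left)
qed

lemma multisum_0: "multisum g 0 = g 0"
proof -
  have "mult_vectors 0 = {\<lambda>k. 0}" by (auto simp: mult_vectors_def)
  then show ?thesis by (simp add: multisum_def)
qed

text \<open>With \<open>A = \<Sum> a\<^sub>m X\<^sup>m\<close>, the coefficients of \<open>1/A\<close> and of \<open>log A\<close> are multisums;
  the recurrence for \<open>c\<close> says \<open>X A' = C A\<close>, hence \<open>C = X (log A)'\<close>.\<close>
lemma multisum_log_derivative:
  assumes a0: "a 0 = 1" and rec: "\<And>m. real m * a m = (\<Sum>j=1..m. c j * a (m - j))" and m: "1 \<le> m"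
  shows "c m = real m * multisum (\<lambda>q. (-1) ^ (q - 1) * fact (q - 1)) m"
proof -
  define U where "U = multisum (\<lambda>q. (-1) ^ q * fact q)"
  \<comment> \<open>The recurrence leaves \<open>c 0\<close> open, whereas X A' has constant term 0;
    so the series C has to start with 0.\<close>
  define c' where "c' j = (if j = 0 then 0 else c j)" for j
  have split: "(\<Sum>j=0..m. f j) = f 0 + (\<Sum>j=1..m. f j)" for f :: "nat \<Rightarrow> real" and m
    by (simp add: sum.atLeast_Suc_atMost)
  have 1: "Abs_fps c' * Abs_fps a = Abs_fps (\<lambda>m. real m * a m)"
    by (rule fps_ext) (simp add: fps_mult_nth rec split c'_def)
  have 2: "Abs_fps a * Abs_fps U = 1"
  proof (rule fps_ext)
    fix m
    show "fps_nth (Abs_fps a * Abs_fps U) m = fps_nth 1 m"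
      using multisum_inverse[of m] by (cases "m = 0") (auto simp: fps_mult_nth split a0 U_def multisum_0)
  qed
  have "Abs_fps c' = Abs_fps c' * (Abs_fps a * Abs_fps U)" by (simp add: 2)
  also have "\<dots> = Abs_fps (\<lambda>m. real m * a m) * Abs_fps U" by (simp add: 1 mult.assoc[symmetric])
  finally have "c' m = fps_nth (Abs_fps (\<lambda>m. real m * a m) * Abs_fps U) m" by (metis fps_nth_Abs_fps)
  also have "\<dots> = real m * multisum (\<lambda>q. (-1) ^ (q - 1) * fact (q - 1)) m"
    unfolding multisum_log by (simp add: fps_mult_nth split U_def)
  finally show ?thesis using m by (simp add: c'_def)
qed

end

section \<open>Moebius inversion\<close>

text \<open>Adding or removing a fixed element \<open>p\<close> pairs the subsets with opposite
  signs.\<close>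

lemma sum_neg_one_power_card_Pow:
  assumes "finite S" "S \<noteq> {}"
  shows "(\<Sum>X\<in>Pow S. (-1) ^ card X) = (0::int)"
proof -
  obtain p where p: "p \<in> S" using assms by blast
  define S' where "S' = S - {p}"
  have S: "S = insert p S'" "p \<notin> S'" "finite S'" using p assms by (auto simp: S'_def)
  have "(\<Sum>X\<in>Pow S. (-1) ^ card X) = (\<Sum>X\<in>Pow S'. (-1) ^ card X) + (\<Sum>X\<in>insert p ` Pow S'. (-1::int) ^ card X)"
    unfolding S(1) Pow_insert by (rule sum.union_disjoint) (use S in auto)
  also have "(\<Sum>X\<in>insert p ` Pow S'. (-1::int) ^ card X) = (\<Sum>X\<in>Pow S'. (-1) ^ card (insert p X))"
    using S(2) by (subst sum.reindex) (auto simp: inj_on_def)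
  also have "\<dots> = (\<Sum>X\<in>Pow S'. - ((-1) ^ card X))"
  proof (rule sum.cong[OF refl])
    fix X assume "X \<in> Pow S'"
    then have "finite X" "p \<notin> X" using S finite_subset by auto
    then show "(-1) ^ card (insert p X) = - ((-1::int) ^ card X)" by simp
  qed
  finally show ?thesis by (simp add: sum_negf)
qed

lemma prime_factors_prod_primes:
  assumes "finite X" "\<And>p. p \<in> X \<Longrightarrow> prime (p::nat)"
  shows "prime_factors (\<Prod>X) = X"
  using assms
proof (induction X rule: finite_induct)
  case (insert p X)
  have ne: "\<Prod>X \<noteq> 0" using insert by (auto dest: prime_gt_0_nat)
  have "prime_factors (p * \<Prod>X) = prime_factors p \<union> prime_factors (\<Prod>X)"
    using ne insert.prems[of p] by (intro prime_factors_product) auto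
  then show ?case using insert by (simp add: prime_prime_factors)
qed simp

lemma squarefree_prod_prime_factors:
  assumes "squarefree (e::nat)"
  shows "\<Prod>(prime_factors e) = e"
proof -
  have e: "e \<noteq> 0" using assms by (metis not_squarefree_0)
  have "(\<Prod>p\<in>prime_factors e. p ^ multiplicity p e) = e"
    using prime_factorization_nat[of e] e by simp
  moreover have "multiplicity p e = 1" if "p \<in> prime_factors e" for p
    using that e assms squarefree_factorial_semiring'[of e] by (auto simp: Let_def)
  ultimately show ?thesis by simp
qed

text \<open>Only squarefree divisors count, and these correspond to the subsets of the prime factors
  of \<open>n\<close>, so the sum is the alternating one over a power set.\<close>

lemma sum_moebius_mu_divisors:
  assumes n: "n \<noteq> 0"
  shows "(\<Sum>e | e dvd n. moebius_mu e) = (if n = 1 then 1 else 0)"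
proof -
  let ?P = "prime_factors n"
  have "(\<Sum>e | e dvd n. moebius_mu e) = (\<Sum>e | e dvd n \<and> squarefree e. (-1) ^ card (prime_factors e))"
    using n by (intro sum.mono_neutral_cong_right) (auto simp: moebius_mu_def intro: finite_divisors_nat)
  also have "\<dots> = (\<Sum>X\<in>Pow ?P. (-1) ^ card X)"
  proof (rule sum.reindex_bij_witness[of _ "\<lambda>X. \<Prod>X" prime_factors])
    fix X assume X: "X \<in> Pow ?P"
    then have fin: "finite X" and p: "\<And>p. p \<in> X \<Longrightarrow> prime p" using finite_subset by auto
    show pf: "prime_factors (\<Prod>X) = X" by (rule prime_factors_prod_primes[OF fin p])
    have sq: "squarefree (\<Prod>X)"
      using p by (intro squarefree_prod_coprime) (auto intro: primes_coprime squarefree_prime)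
    have "\<Prod>X dvd (\<Prod>p\<in>?P. p)" using X by (intro prod_dvd_prod_subset) auto
    also have "\<dots> dvd (\<Prod>p\<in>?P. p ^ multiplicity p n)"
      by (rule prod_dvd_prod) (auto simp: prime_factors_multiplicity intro: dvd_power)
    also have "\<dots> = n" using prime_factorization_nat[of n] n by simp
    finally have "\<Prod>X dvd n" .
    then show "\<Prod>X \<in> {e. e dvd n \<and> squarefree e}" using sq by simp
  next
    fix e assume e: "e \<in> {e. e dvd n \<and> squarefree e}"
    show "\<Prod>(prime_factors e) = e" using e by (intro squarefree_prod_prime_factors) simp
    show "prime_factors e \<in> Pow ?P" using e n dvd_prime_factors by blast
  qed simp
  also have "\<dots> = (if n = 1 then 1 else 0)"
  proof (cases "n = 1")
    case False
    then have "?P \<noteq> {}" using n by (simp add: prime_factorization_empty_iff)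
    then show ?thesis using False sum_neg_one_power_card_Pow[of ?P] by simp
  qed simp
  finally show ?thesis .
qed

text \<open>After exchanging the sums, \<open>f e\<close> is multiplied by the sum of
  \<open>moebius_mu\<close> over the divisors of \<open>d div e\<close>, which vanishes unless
  \<open>e = d\<close>. The relation is asked for only from 1 on, because 0 has infinitely many
  divisors.\<close>

lemma moebius_mu_inversion:
  fixes f c :: "nat \<Rightarrow> real"
  assumes d: "1 \<le> d" and c: "\<And>m. 1 \<le> m \<Longrightarrow> c m = (\<Sum>e | e dvd m. f e)"
  shows "f d = (\<Sum>m | m dvd d. real_of_int (moebius_mu (d div m)) * c m)"
proof -
  have fin: "finite {m. m dvd d}" using d by (intro finite_divisors_nat) simp
  have "(\<Sum>m | m dvd d. real_of_int (moebius_mu (d div m)) * c m) =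
      (\<Sum>m | m dvd d. \<Sum>e | e dvd d. if e dvd m then real_of_int (moebius_mu (d div m)) * f e else 0)"
  proof (rule sum.cong[OF refl])
    fix m assume "m \<in> {m. m dvd d}"
    then have m: "m dvd d" "1 \<le> m" using d by (auto intro: Suc_leI dvd_pos_nat)
    have "(\<Sum>e | e dvd d. if e dvd m then real_of_int (moebius_mu (d div m)) * f e else 0) =
      (\<Sum>e | e \<in> {e. e dvd d} \<and> e dvd m. real_of_int (moebius_mu (d div m)) * f e)"
      by (rule sum.inter_filter[OF fin, symmetric])
    also have "{e. e \<in> {e. e dvd d} \<and> e dvd m} = {e. e dvd m}" using m dvd_trans by auto
    finally show "real_of_int (moebius_mu (d div m)) * c m =
      (\<Sum>e | e dvd d. if e dvd m then real_of_int (moebius_mu (d div m)) * f e else 0)"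
      by (simp add: c[OF m(2)] sum_distrib_left)
  qed
  also have "\<dots> = (\<Sum>e | e dvd d. \<Sum>m | m dvd d. if e dvd m then real_of_int (moebius_mu (d div m)) * f e else 0)"
    by (rule sum.swap)
  also have "\<dots> = (\<Sum>e | e dvd d. if e = d then f e else 0)"
  proof (rule sum.cong[OF refl])
    fix e assume "e \<in> {e. e dvd d}"
    then have e: "e dvd d" "0 < e" using d by (auto intro: dvd_pos_nat)
    then obtain q where q: "d = e * q" by blast
    have q0: "q \<noteq> 0" using d q by (cases q) auto
    have "(\<Sum>m | m dvd d. if e dvd m then real_of_int (moebius_mu (d div m)) * f e else 0) =
      (\<Sum>m | m \<in> {m. m dvd d} \<and> e dvd m. real_of_int (moebius_mu (d div m)) * f e)"
      by (rule sum.inter_filter[OF fin, symmetric])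
    also have "\<dots> = (\<Sum>k | k dvd q. real_of_int (moebius_mu k) * f e)"
    \<comment> \<open>With \<open>d = e * q\<close>, passing to the complementary divisor
      \<open>d div m\<close> maps the multiples of \<open>e\<close> among the divisors of
      \<open>d\<close> onto the divisors of \<open>q\<close>.\<close>
    proof (rule sum.reindex_bij_witness[of _ "\<lambda>k. d div k" "\<lambda>m. d div m"])
      fix m assume "m \<in> {m. m \<in> {m. m dvd d} \<and> e dvd m}"
      then obtain u v where m: "m = e * u" "d = m * v" unfolding dvd_def by blast
      then have "q = u * v" "0 < m" using q e(2) d by auto
      then show "d div m \<in> {k. k dvd q}" "d div (d div m) = m" using m d by auto
    next
      fix k assume "k \<in> {k. k dvd q}"
      then obtain u where "q = k * u" by auto
      then show "d div k \<in> {m. m \<in> {m. m dvd d} \<and> e dvd m}" "d div (d div k) = k" 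
        using q e(2) q0 by auto
    qed simp
    also have "\<dots> = real_of_int (\<Sum>k | k dvd q. moebius_mu k) * f e"
      by (simp add: sum_distrib_right)
    also have "\<dots> = (if e = d then f e else 0)"
      unfolding sum_moebius_mu_divisors[OF q0] using q e(2) by auto
    finally show "(\<Sum>m | m dvd d. if e dvd m then real_of_int (moebius_mu (d div m)) * f e else 0) =
      (if e = d then f e else 0)" .
  qed
  also have "\<dots> = f d" using fin by (simp add: sum.delta')
  finally show ?thesis by simp
qed

section \<open>The formula\<close>

theorem theorem8:
  fixes r d :: nat
  assumes "r \<ge> 1" and "d \<ge> 1"
  shows "real (num_transitive_classes r d) = theorem8_formula r d"
proof -
  interpret weighted_types fst "trans_types r" by (rule weighted_types_trans_types)
  define a where "a m = real (card (weighted_msets fst (trans_types r) m))" for m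
  define f where "f e = real (e * card {\<tau> \<in> trans_types r. fst \<tau> = e})" for e
  \<comment> \<open>Truncated subtraction makes \<open>g 0 = 1\<close>, so
    \<open>multisum a g 0\<close> is not the constant term of log A; this does no harm because all
    divisors of \<open>d\<close> are positive.\<close>
  define g :: "nat \<Rightarrow> real" where "g = (\<lambda>q. (-1) ^ (q - 1) * fact (q - 1))"
  have rec: "real m * a m = (\<Sum>j=1..m. (\<Sum>e | e dvd j. f e) * a (m - j))" for m
    unfolding a_def f_def of_nat_sum[symmetric] of_nat_mult[symmetric]
    by (simp only: card_weighted_msets_recurrence)
  have log: "real m * multisum a g m = (\<Sum>e | e dvd m. f e)" if "1 \<le> m" for m
    unfolding g_def
    by (rule multisum_log_derivative[symmetric, OF _ rec that]) (simp add: a_def card_weighted_msets_0)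
  have a: "a k = (\<Sum>\<kappa>\<in>mult_vectors k. real (z_part k \<kappa>) ^ (r - 1))" for k
    by (simp add: a_def card_weighted_msets_trans_types[OF assms(1)])
  have "f d = (\<Sum>m | m dvd d. real_of_int (moebius_mu (d div m)) * (real m * multisum a g m))"
    by (rule moebius_mu_inversion[OF assms(2) log])
  moreover have "f d = real d * real (num_transitive_classes r d)"
    by (simp add: f_def num_transitive_classes_eq[OF assms(2)])
  moreover have "theorem8_formula r d =
      1 / real d * (\<Sum>m | m dvd d. real_of_int (moebius_mu (d div m)) * (real m * multisum a g m))"
    \<comment> \<open>\<open>multisum\<close> keeps powers and factorials in one product, the
      formula in two; \<open>prod_dividef\<close> separates them.\<close>
    unfolding theorem8_formula_def multisum_def g_def a Let_def prod_dividef
    by (simp add: mult_ac)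
  ultimately have "real d * real (num_transitive_classes r d) = real d * theorem8_formula r d"
    using assms(2) by simp
  then show ?thesis using assms(2) by simp
qed

end
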